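(* Let $g \ge 1$ and let $a_1,\ldots,a_{g+1} \in \mathbb{Q}^\times$ be such that $a_1^2,\ldots,a_{g+1}^2$ are pairwise distinct. Let $V=\left(a_i^{2j}\right)_{1\le i \le g+1,\ 0 \le j \le g}\in \mathrm{GL}_{g+1}(\mathbb{Q})$ be the Vandermonde matrix, let $w = \left(-2a^{2g+1}_i\right)_{1\le i \le g+1} \in \mathbb{Q}^{g+1}$, define $(b_0,\ldots,b_g) = V^{-1} w \in \mathbb{Q}^{g+1}$ and put $f_1(x) = b_0+b_1x+\ldots + b_gx^g$. Assume that $\mathrm{disc}(-4x^{2g+1}+f_1(x)^2)\neq 0$, and let $C$ be the hyperelliptic curve (smooth projective model) associated to the affine model $$y^2+f_1(x)y+x^{2g+1} =0 .$$ Let $\infty$ be the unique point at infinity on $C$ and $O=(0,0)\in C(\mathbb{Q})$. Then, for every $i\in\{1,\ldots,g+1\}$, the points $\infty$, $O$ and $P_i = (a^2_i,a_i^{2g+1}) \in C(\mathbb{Q})$ define (in the sense explained in the context) an element $\{\infty, O, P_i\}\in K_2^T(C)/\mathrm{torsion}$.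
   Context: For a smooth, projective, geometrically irreducible curve $C/\mathbb{Q}$ let $K_2(\mathbb{Q}(C)) = \mathbb{Q}(C)^\times\otimes_{\mathbb{Z}} \mathbb{Q}(C)^\times/\langle f\otimes (1-f): f \in \mathbb{Q}(C)^\times\setminus\{1\}\rangle$, and write $\{f,h\}$ for the class of $f\otimes h$. For a closed point $P$ of $C$ with residue field $\mathbb{Q}(P)$ the tame symbol is $T_P(\{f,h\}) = (-1)^{\mathrm{ord}_P(f)\mathrm{ord}_P(h)}\frac{f^{\mathrm{ord}_P(h)}}{h^{\mathrm{ord}_P(f)}}(P)\in \mathbb{Q}(P)^\times$, extended linearly to $K_2(\mathbb{Q}(C))$. The tame second $K$-group $K_2^T(C)$ is the subgroup of those $\alpha\in K_2(\mathbb{Q}(C))$ with $T_P(\alpha)=1$ for all closed points $P$. Torsion construction: let $R_1,R_2,R_3\in C(\mathbb{Q})$ be distinct points such that all differences $(R_i)-(R_j)$ have torsion class in $\mathrm{Pic}^0(C)$. With indices in $\mathbb{Z}/3\mathbb{Z}$, let $m_i\ge 1$ be the order of the class of $(R_{i+1})-(R_{i-1})$, let $h_i\in\mathbb{Q}(C)^\times$ satisfy $\mathrm{div}(h_i)=m_i(R_{i+1})-m_i(R_{i-1})$, and put $S_i=\left\{\frac{h_{i+1}}{h_{i+1}(R_{i+1})},\frac{h_{i-1}}{h_{i-1}(R_{i-1})}\right\}$. It is known that $S_i\in K_2^T(C)$ and that there is a unique element $\{R_1,R_2,R_3\}\in K_2^T(C)/\mathrm{torsion}$ with $S_i=\frac{\mathrm{lcm}(m_1,m_2,m_3)}{m_i}\{R_1,R_2,R_3\}$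 for all $i$. Saying that a triple of points defines an element $\{R_1,R_2,R_3\}$ of $K_2^T(C)/\mathrm{torsion}$ means that the three points are distinct rational points whose pairwise differences are torsion in $\mathrm{Pic}^0(C)$, so that this construction applies. *)

theory Defs
  imports
    "HOL-Algebra.QuotRing"
    "HOL-Algebra.Embedded_Algebras"
    "HOL-Algebra.Free_Abelian_Groups"
    "HOL-Computational_Algebra.Polynomial_Factorial"
    "Subresultants.Resultant_Prelim"
    "Jordan_Normal_Form.Gauss_Jordan_Elimination"
begin

section \<open>Smooth projective curves through their function fields\<close>

text \<open>
  A smooth projective (geometrically irreducible) curve \<open>C\<close> over a perfect field \<open>k\<close> is given by its
  function field \<open>K\<close> together with the set \<open>k\<close> of constants inside \<open>K\<close>. Its closed points are the
  normalized discrete valuations of \<open>K\<close> that are trivial on \<open>k\<close>, the point \<open>P\<close> being identified with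
  the function \<open>ord\<^sub>P\<close> on the nonzero elements of \<open>K\<close>; so \<open>P f\<close> below is \<open>ord\<^sub>P(f)\<close>.
  The value at zero, morally infinity, is left \<^const>\<open>undefined\<close> by extensionality, so that
  two closed points are equal exactly if their valuations agree on all nonzero functions.
\<close>

definition closed_points :: "('a, 'm) ring_scheme \<Rightarrow> 'a set \<Rightarrow> ('a \<Rightarrow> int) set" where
  "closed_points K k =
    {P \<in> extensional (carrier K - {\<zero>\<^bsub>K\<^esub>}).
       P ` (carrier K - {\<zero>\<^bsub>K\<^esub>}) = UNIV \<and>
       (\<forall>f \<in> carrier K - {\<zero>\<^bsub>K\<^esub>}. \<forall>h \<in> carrier K - {\<zero>\<^bsub>K\<^esub>}.
          P (f \<otimes>\<^bsub>K\<^esub> h) = P f + P h \<and>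
          (f \<oplus>\<^bsub>K\<^esub> h \<noteq> \<zero>\<^bsub>K\<^esub> \<longrightarrow> min (P f) (P h) \<le> P (f \<oplus>\<^bsub>K\<^esub> h))) \<and>
       (\<forall>c \<in> k - {\<zero>\<^bsub>K\<^esub>}. P c = 0)}"

definition local_ring :: "('a, 'm) ring_scheme \<Rightarrow> ('a \<Rightarrow> int) \<Rightarrow> 'a set" where
  "local_ring K P = {f \<in> carrier K. f = \<zero>\<^bsub>K\<^esub> \<or> 0 \<le> P f}"

definition local_maximal_ideal :: "('a, 'm) ring_scheme \<Rightarrow> ('a \<Rightarrow> int) \<Rightarrow> 'a set" where
  "local_maximal_ideal K P = {f \<in> carrier K. f = \<zero>\<^bsub>K\<^esub> \<or> 0 < P f}"

definition residue_field :: "('a, 'm) ring_scheme \<Rightarrow> ('a \<Rightarrow> int) \<Rightarrow> 'a set ring" where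
  "residue_field K P = (K\<lparr>carrier := local_ring K P\<rparr>) Quot local_maximal_ideal K P"

definition residue_constants :: "('a, 'm) ring_scheme \<Rightarrow> 'a set \<Rightarrow> ('a \<Rightarrow> int) \<Rightarrow> 'a set set" where
  "residue_constants K k P = (\<lambda>c. local_maximal_ideal K P +>\<^bsub>K\<^esub> c) ` k"

definition rational_points :: "('a, 'm) ring_scheme \<Rightarrow> 'a set \<Rightarrow> ('a \<Rightarrow> int) set" where
  "rational_points K k =
    {P \<in> closed_points K k. carrier (residue_field K P) = residue_constants K k P}"

definition point_degree :: "('a, 'm) ring_scheme \<Rightarrow> 'a set \<Rightarrow> ('a \<Rightarrow> int) \<Rightarrow> nat" where
  "point_degree K k P =
    (THE n. ring.dimension (residue_field K P) n (residue_constants K k P)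
              (carrier (residue_field K P)))"

definition divisor_group ::
    "('a, 'm) ring_scheme \<Rightarrow> 'a set \<Rightarrow> (('a \<Rightarrow> int) \<Rightarrow>\<^sub>0 int) monoid" where
  "divisor_group K k = free_Abelian_group (closed_points K k)"

definition divisor_degree ::
    "('a, 'm) ring_scheme \<Rightarrow> 'a set \<Rightarrow> (('a \<Rightarrow> int) \<Rightarrow>\<^sub>0 int) \<Rightarrow> int" where
  "divisor_degree K k D =
    (\<Sum>P \<in> Poly_Mapping.keys D. Poly_Mapping.lookup D P * int (point_degree K k P))"

definition principal_divisors ::
    "('a, 'm) ring_scheme \<Rightarrow> 'a set \<Rightarrow> (('a \<Rightarrow> int) \<Rightarrow>\<^sub>0 int) set" where
  "principal_divisors K k =
    {D \<in> carrier (divisor_group K k).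
       \<exists>f \<in> carrier K - {\<zero>\<^bsub>K\<^esub>}. \<forall>P \<in> closed_points K k. Poly_Mapping.lookup D P = P f}"

definition divisor_class ::
    "('a, 'm) ring_scheme \<Rightarrow> 'a set \<Rightarrow> (('a \<Rightarrow> int) \<Rightarrow>\<^sub>0 int) \<Rightarrow> (('a \<Rightarrow> int) \<Rightarrow>\<^sub>0 int) set" where
  "divisor_class K k D = principal_divisors K k #>\<^bsub>divisor_group K k\<^esub> D"

definition Pic0 ::
    "('a, 'm) ring_scheme \<Rightarrow> 'a set \<Rightarrow> (('a \<Rightarrow> int) \<Rightarrow>\<^sub>0 int) set monoid" where
  "Pic0 K k =
    (divisor_group K k Mod principal_divisors K k)
      \<lparr>carrier := divisor_class K k `
         {D \<in> carrier (divisor_group K k). divisor_degree K k D = 0}\<rparr>"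

definition torsion_elements :: "('a, 'm) monoid_scheme \<Rightarrow> 'a set" where
  "torsion_elements G = {c \<in> carrier G. \<exists>n::nat. n \<ge> 1 \<and> c [^]\<^bsub>G\<^esub> n = \<one>\<^bsub>G\<^esub>}"

text \<open>
  The torsion construction of an element \<open>{R\<^sub>1, R\<^sub>2, R\<^sub>3}\<close> of the tame second K-group modulo torsion
  applies to three distinct rational points whose pairwise differences are torsion in \<open>Pic\<^sup>0\<close>; a triple
  is said to define such an element exactly if it satisfies these conditions.
\<close>

definition defines_tame_K2_element ::
    "('a, 'm) ring_scheme \<Rightarrow> 'a set \<Rightarrow> ('a \<Rightarrow> int) \<Rightarrow> ('a \<Rightarrow> int) \<Rightarrow> ('a \<Rightarrow> int) \<Rightarrow> bool" where
  "defines_tame_K2_element K k R1 R2 R3 \<longleftrightarrow>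
     {R1, R2, R3} \<subseteq> rational_points K k \<and>
     distinct [R1, R2, R3] \<and>
     (\<forall>P \<in> {R1, R2, R3}. \<forall>Q \<in> {R1, R2, R3}.
        divisor_class K k (frag_of P - frag_of Q) \<in> torsion_elements (Pic0 K k))"


section \<open>The curves \<open>y\<^sup>2 + f(x) y + h(x) = 0\<close> over the rationals\<close>

text \<open>
  The function field is \<open>\<rat>(x)[y]/(y\<^sup>2 + f y + h)\<close>, the pair \<open>(u, v)\<close> standing for \<open>u + v y\<close>.
  It is a field if the quadratic polynomial is irreducible over \<open>\<rat>(x)\<close>, and is then the
  fraction field of the coordinate ring \<open>\<rat>[x,y]/(y\<^sup>2 + f y + h)\<close> of the affine model.
\<close>

type_synonym hyp_function = "rat poly fract \<times> rat poly fract"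

definition hyp_function_field :: "rat poly \<Rightarrow> rat poly \<Rightarrow> hyp_function ring" where
  "hyp_function_field f h =
    \<lparr>carrier = UNIV,
     monoid.mult = (\<lambda>(u, v) (u', v').
       (u * u' - v * v' * to_fract h, u * v' + v * u' - v * v' * to_fract f)),
     monoid.one = (1, 0),
     ring.zero = (0, 0),
     ring.add = (\<lambda>(u, v) (u', v'). (u + u', v + v'))\<rparr>"

definition hyp_const :: "rat \<Rightarrow> hyp_function" where
  "hyp_const c = (to_fract [:c:], 0)"

abbreviation hyp_constants :: "hyp_function set" where
  "hyp_constants \<equiv> range hyp_const"

definition coord_x :: hyp_function where
  "coord_x = (to_fract [:0, 1:], 0)"

definition coord_y :: hyp_function where
  "coord_y = (0, 1)"

text \<open>
  The closed points of the smooth projective model lying over the rational point \<open>(r, s)\<close> of the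
  affine model, i.e. those at which \<open>x\<close> is regular with value \<open>r\<close> and \<open>y\<close> is regular with value \<open>s\<close>.
\<close>

definition points_over :: "rat poly \<Rightarrow> rat poly \<Rightarrow> rat \<Rightarrow> rat \<Rightarrow> (hyp_function \<Rightarrow> int) set" where
  "points_over f h r s =
    (let K = hyp_function_field f h in
     {P \<in> closed_points K hyp_constants.
        coord_x \<ominus>\<^bsub>K\<^esub> hyp_const r \<in> local_maximal_ideal K P \<and>
        coord_y \<ominus>\<^bsub>K\<^esub> hyp_const s \<in> local_maximal_ideal K P})"

text \<open>The points at infinity are those at which \<open>x\<close> and \<open>y\<close> are not both regular.\<close>

definition points_at_infinity :: "rat poly \<Rightarrow> rat poly \<Rightarrow> (hyp_function \<Rightarrow> int) set" where
  "points_at_infinity f h =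
    (let K = hyp_function_field f h in
     {P \<in> closed_points K hyp_constants. \<not> {coord_x, coord_y} \<subseteq> local_ring K P})"


section \<open>The Vandermonde data\<close>

text \<open>Rows and columns of matrices are indexed from 0, whereas the \<open>a\<^sub>i\<close> are indexed from 1.\<close>

definition vandermonde_mat :: "nat \<Rightarrow> (nat \<Rightarrow> rat) \<Rightarrow> rat mat" where
  "vandermonde_mat g a = mat (g + 1) (g + 1) (\<lambda>(i, j). a (i + 1) ^ (2 * j))"

definition w_vec :: "nat \<Rightarrow> (nat \<Rightarrow> rat) \<Rightarrow> rat vec" where
  "w_vec g a = vec (g + 1) (\<lambda>i. - 2 * a (i + 1) ^ (2 * g + 1))"

definition b_vec :: "nat \<Rightarrow> (nat \<Rightarrow> rat) \<Rightarrow> rat vec" where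
  "b_vec g a = the (mat_inverse (vandermonde_mat g a)) *\<^sub>v w_vec g a"

definition f1_poly :: "nat \<Rightarrow> (nat \<Rightarrow> rat) \<Rightarrow> rat poly" where
  "f1_poly g a = (\<Sum>j = 0..g. monom (b_vec g a $ j) j)"

text \<open>
  The discriminant of a polynomial of degree \<open>n \<ge> 1\<close>. In characteristic 0 the derivative has degree
  exactly \<open>n - 1\<close>, so that the resultant has its usual format.
\<close>

definition poly_disc :: "'a::field_char_0 poly \<Rightarrow> 'a" where
  "poly_disc p =
    (- 1) ^ (degree p * (degree p - 1) div 2) * resultant p (pderiv p) / lead_coeff p"

end

theory Submission
  imports Defs "HOL-Computational_Algebra.Field_as_Ring" "Subresultants.Subresultant_Gcd"
begin

text \<open>
  Write \<open>f\<close> for \<open>f\<^sub>1\<close>, put \<open>h = x\<^bsup>2g+1\<^esup>\<close>, and let \<open>D = f\<^sup>2 - 4 h\<close> be the discriminant of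
  \<open>y\<^sup>2 + f y + h\<close> as a polynomial in \<open>y\<close>. The Vandermonde system says exactly that
  \<open>f(a\<^sub>i\<^sup>2) = - 2 a\<^sub>i\<^bsup>2g+1\<^esup>\<close>, so over \<open>x = a\<^sub>i\<^sup>2\<close> the equation becomes
  \<open>(y - a\<^sub>i\<^bsup>2g+1\<^esup>)\<^sup>2 = 0\<close>. Hence \<open>P\<^sub>i\<close> is the only point in its fibre, and
  \<open>div (x - a\<^sub>i\<^sup>2) = 2 (P\<^sub>i) - 2 (\<infinity>)\<close>. On the other hand \<open>y (y + f) = - x\<^bsup>2g+1\<^esup>\<close>, and at \<open>O\<close> the
  factor \<open>y + f\<close> is a unit because \<open>f(0) \<noteq> 0\<close>; so \<open>div y = (2g+1) (O) - (2g+1) (\<infinity>)\<close>. Thus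
  \<open>(O) - (\<infinity>)\<close> and \<open>(P\<^sub>i) - (\<infinity>)\<close> are torsion, and with them all differences of the three points.

  The substance is that each of \<open>\<infinity>\<close>, \<open>O\<close>, \<open>P\<^sub>i\<close> is one rational closed point at which the orders of
  \<open>x\<close> and \<open>y\<close> are as claimed. Closed points being valuations, existence and uniqueness must be
  proved. All three cases are instances of one statement, \<open>origin_closed_point\<close>: if
  \<open>Y\<^sup>2 + F(X) Y + H(X) = 0\<close> is an affine model of the function field with a smooth point at the origin,
  then exactly one closed point lies over the origin, it is rational, and \<open>X\<close> has order 1 or 2 there
  according to whether \<open>F(0) \<noteq> 0\<close>. For \<open>O\<close> and \<open>P\<^sub>i\<close> one translates the coordinates; for \<open>\<infinity>\<close> one takes
  \<open>X = 1/x\<close> and \<open>Y = y/x\<^bsup>g+1\<^esup>\<close>, for which \<open>H = X\<close>. Smoothness at \<open>O\<close> and at the \<open>P\<^sub>i\<close> is where the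
  discriminant enters: \<open>f(0) = 0\<close> would make \<open>0\<close> a double root of \<open>D\<close>, and at \<open>P\<^sub>i\<close> the condition is
  that the root \<open>a\<^sub>i\<^sup>2\<close> of \<open>D\<close> is simple.

  The statement about the origin rests on the locale \<open>local_parameter\<close>. If every nonzero function is
  \<open>t\<^sup>n A / B\<close> with \<open>A\<close>, \<open>B\<close> in a subring on which evaluation at the point makes sense and does not
  kill \<open>A\<close> and \<open>B\<close>, and if \<open>t\<close> vanishes at the point, then \<open>n\<close> is the value of a discrete valuation,
  and every normalized valuation that is positive on the functions vanishing at the point equals it.
\<close>

(* The literal form of linear polynomials [:c, 1:] has to survive simplification. *)
declare pCons_one [simp del]

section \<open>Closed points as valuations\<close>

context field
begin

lemma nonzero_mult_closed:
  "f \<in> carrier R - {\<zero>} \<Longrightarrow> h \<in> carrier R - {\<zero>} \<Longrightarrow> f \<otimes> h \<in> carrier R - {\<zero>}"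
  using integral by auto

lemma nonzero_inv_closed: "f \<in> carrier R - {\<zero>} \<Longrightarrow> inv f \<in> carrier R - {\<zero>}"
  using field_Units Units_inv_Units by blast

lemma nonzero_pow_closed: "f \<in> carrier R - {\<zero>} \<Longrightarrow> f [^] (n::nat) \<in> carrier R - {\<zero>}"
  by (induction n) (auto simp: integral_iff)

context
  fixes k P
  assumes P: "P \<in> closed_points R k"
begin

lemma closed_point_mult:
  "f \<in> carrier R - {\<zero>} \<Longrightarrow> h \<in> carrier R - {\<zero>} \<Longrightarrow> P (f \<otimes> h) = P f + P h"
  using P by (auto simp: closed_points_def)

lemma closed_point_add:
  "f \<in> carrier R - {\<zero>} \<Longrightarrow> h \<in> carrier R - {\<zero>} \<Longrightarrow> f \<oplus> h \<noteq> \<zero> \<Longrightarrow> min (P f) (P h) \<le> P (f \<oplus> h)"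
  using P by (auto simp: closed_points_def)

lemma closed_point_const: "c \<in> k \<Longrightarrow> c \<noteq> \<zero> \<Longrightarrow> P c = 0"
  using P by (auto simp: closed_points_def)

lemma closed_point_surj: "\<exists>f \<in> carrier R - {\<zero>}. P f = n"
proof -
  have "P ` (carrier R - {\<zero>}) = UNIV"
    using P by (simp add: closed_points_def)
  then show ?thesis by (metis UNIV_I image_iff)
qed

lemma closed_point_one: "P \<one> = 0"
  using closed_point_mult[of \<one> \<one>] by simp

lemma closed_point_minus:
  assumes "f \<in> carrier R - {\<zero>}"
  shows "P (\<ominus> f) = P f"
proof -
  (* The value group is torsion free, so it is enough to compare squares. *)
  have "(\<ominus> f) \<otimes> (\<ominus> f) = f \<otimes> f"
    using assms by (simp add: l_minus r_minus)
  moreover have "\<ominus> f \<in> carrier R - {\<zero>}"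
    using assms by auto
  ultimately show ?thesis
    using closed_point_mult[of f f] closed_point_mult[of "\<ominus> f" "\<ominus> f"] assms by auto
qed

lemma closed_point_pow: "f \<in> carrier R - {\<zero>} \<Longrightarrow> P (f [^] (n::nat)) = int n * P f"
proof (induction n)
  case (Suc n)
  then show ?case
    using closed_point_mult[OF nonzero_pow_closed[of f n], of f] by (simp add: algebra_simps)
qed (simp add: closed_point_one)

lemma closed_point_inv:
  assumes "f \<in> carrier R - {\<zero>}"
  shows "P (inv f) = - P f"
proof -
  have "f \<otimes> inv f = \<one>"
    using assms field_Units by auto
  then show ?thesis
    using closed_point_mult[OF assms nonzero_inv_closed[OF assms]] closed_point_one by simp
qed

lemma local_maximal_ideal_subset: "local_maximal_ideal R P \<subseteq> local_ring R P"
  by (auto simp: local_ring_def local_maximal_ideal_def)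

lemma local_ring_subring: "subring (local_ring R P) R"
proof (rule subringI)
  show "f \<oplus> h \<in> local_ring R P" if "f \<in> local_ring R P" "h \<in> local_ring R P" for f h
    using that closed_point_add[of f h] by (fastforce simp: local_ring_def)
  show "f \<otimes> h \<in> local_ring R P" if "f \<in> local_ring R P" "h \<in> local_ring R P" for f h
    using that closed_point_mult[of f h] by (cases "f = \<zero>"; cases "h = \<zero>") (auto simp: local_ring_def)
  show "\<ominus> f \<in> local_ring R P" if "f \<in> local_ring R P" for f
    using that closed_point_minus[of f] by (cases "f = \<zero>") (auto simp: local_ring_def)
qed (auto simp: local_ring_def closed_point_one)

lemma local_maximal_ideal_add:
  "f \<in> local_maximal_ideal R P \<Longrightarrow> h \<in> local_maximal_ideal R P \<Longrightarrow>
     f \<oplus> h \<in> local_maximal_ideal R P"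
  using closed_point_add[of f h] by (fastforce simp: local_maximal_ideal_def)

lemma local_maximal_ideal_mult:
  "f \<in> local_ring R P \<Longrightarrow> h \<in> local_maximal_ideal R P \<Longrightarrow> f \<otimes> h \<in> local_maximal_ideal R P"
  using closed_point_mult[of f h]
  by (cases "f = \<zero>"; cases "h = \<zero>") (auto simp: local_maximal_ideal_def local_ring_def)

lemma local_maximal_ideal_minus:
  "f \<in> local_maximal_ideal R P \<Longrightarrow> \<ominus> f \<in> local_maximal_ideal R P"
  using closed_point_minus[of f] by (cases "f = \<zero>") (auto simp: local_maximal_ideal_def)

lemma local_maximal_ideal_ideal:
  "ideal (local_maximal_ideal R P) (R\<lparr>carrier := local_ring R P\<rparr>)"
proof -
  have sub: "subring (local_ring R P) R" by (rule local_ring_subring)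
  interpret L: cring "R\<lparr>carrier := local_ring R P\<rparr>"
    using subcringI'[OF sub] subcring_iff[OF subringE(1)[OF sub]] by blast
  show ?thesis
  proof (rule idealI[OF L.ring_axioms])
    show "subgroup (local_maximal_ideal R P) (add_monoid (R\<lparr>carrier := local_ring R P\<rparr>))"
    proof (rule L.add.subgroupI)
      fix f assume f: "f \<in> local_maximal_ideal R P"
      have "\<ominus>\<^bsub>R\<lparr>carrier := local_ring R P\<rparr>\<^esub> f = \<ominus> f"
        by (rule L.minus_equality)
           (use f subringE[OF sub] local_maximal_ideal_subset in \<open>auto simp: l_neg subset_iff\<close>)
      then show "\<ominus>\<^bsub>R\<lparr>carrier := local_ring R P\<rparr>\<^esub> f \<in> local_maximal_ideal R P"
        using local_maximal_ideal_minus[OF f] by simp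
    qed (use local_maximal_ideal_subset local_maximal_ideal_add in
          \<open>auto simp: local_maximal_ideal_def\<close>)
  next
    fix f h assume fh: "f \<in> local_maximal_ideal R P"
      "h \<in> carrier (R\<lparr>carrier := local_ring R P\<rparr>)"
    then show "h \<otimes>\<^bsub>R\<lparr>carrier := local_ring R P\<rparr>\<^esub> f \<in> local_maximal_ideal R P"
      using local_maximal_ideal_mult by simp
    moreover have "f \<otimes> h = h \<otimes> f"
      using fh by (intro m_comm) (auto simp: local_maximal_ideal_def local_ring_def)
    ultimately show "f \<otimes>\<^bsub>R\<lparr>carrier := local_ring R P\<rparr>\<^esub> h \<in> local_maximal_ideal R P"
      by simp
  qed
qed

text \<open>An element of order 0 is inverted inside the local ring, so any larger ideal is everything.\<close>
lemma residue_field_field: "field (residue_field R P)"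
proof -
  have sub: "subring (local_ring R P) R" by (rule local_ring_subring)
  interpret L: cring "R\<lparr>carrier := local_ring R P\<rparr>"
    using subcringI'[OF sub] subcring_iff[OF subringE(1)[OF sub]] by blast
  have "maximalideal (local_maximal_ideal R P) (R\<lparr>carrier := local_ring R P\<rparr>)"
  proof (rule maximalidealI[OF local_maximal_ideal_ideal])
    have "\<one> \<in> local_ring R P" "\<one> \<notin> local_maximal_ideal R P"
      by (auto simp: local_ring_def local_maximal_ideal_def closed_point_one)
    then show "carrier (R\<lparr>carrier := local_ring R P\<rparr>) \<noteq> local_maximal_ideal R P"
      by auto
  next
    fix J assume J: "ideal J (R\<lparr>carrier := local_ring R P\<rparr>)"
      and sub: "local_maximal_ideal R P \<subseteq> J" "J \<subseteq> carrier (R\<lparr>carrier := local_ring R P\<rparr>)"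
    show "J = local_maximal_ideal R P \<or> J = carrier (R\<lparr>carrier := local_ring R P\<rparr>)"
    proof (rule disjCI)
      assume "J \<noteq> carrier (R\<lparr>carrier := local_ring R P\<rparr>)"
      then have one: "\<one> \<notin> J"
        using ideal.one_imp_carrier[OF J] by auto
      have "f \<in> local_maximal_ideal R P" if f: "f \<in> J" for f
      proof (rule ccontr)
        assume nm: "f \<notin> local_maximal_ideal R P"
        have fl: "f \<in> local_ring R P"
          using f sub by auto
        then have nz: "f \<in> carrier R - {\<zero>}" and "P f = 0"
          using nm by (auto simp: local_ring_def local_maximal_ideal_def)
        then have "inv f \<in> local_ring R P"
          using closed_point_inv[OF nz] nonzero_inv_closed[OF nz] by (auto simp: local_ring_def)
        then have "inv f \<otimes> f \<in> J"
          using ideal.I_l_closed[OF J f, of "inv f"] by simp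
        then show False
          using one nz field_Units by simp
      qed
      then show "J = local_maximal_ideal R P"
        using sub by blast
    qed
  qed
  then show ?thesis
    unfolding residue_field_def using maximalideal.quotient_is_field L.is_cring by blast
qed

end

text \<open>
  The degree is a dimension of the residue field over the constants; for a rational point the two
  coincide, and it remains to use that dimension over a field is well defined.
\<close>
lemma rational_point_degree:
  assumes "P \<in> rational_points R k"
  shows "point_degree R k P = 1"
proof -
  have P: "P \<in> closed_points R k"
    and eq: "residue_constants R k P = carrier (residue_field R P)"
    using assms by (auto simp: rational_points_def)
  interpret F: field "residue_field R P"
    by (rule residue_field_field[OF P])
  have "F.dimension n (carrier (residue_field R P)) (carrier (residue_field R P)) \<longleftrightarrow> n = 1" for n
    using F.dimension_one[OF F.carrier_is_subfield] F.dimension_is_inj[OF F.carrier_is_subfield]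
    by blast
  then show ?thesis
    unfolding point_degree_def eq by simp
qed

lemma rational_pointI:
  assumes P: "P \<in> closed_points R k" and k: "k \<subseteq> local_ring R P"
    and const: "\<And>f. f \<in> local_ring R P \<Longrightarrow> \<exists>c \<in> k. f \<ominus> c \<in> local_maximal_ideal R P"
  shows "P \<in> rational_points R k"
proof -
  let ?L = "R\<lparr>carrier := local_ring R P\<rparr>" and ?M = "local_maximal_ideal R P"
  have sub: "local_ring R P \<subseteq> carrier R"
    by (auto simp: local_ring_def)
  interpret I: ideal ?M ?L
    by (rule local_maximal_ideal_ideal[OF P])
  have coset: "?M +>\<^bsub>?L\<^esub> f = ?M +> f" for f
    by (simp add: a_r_coset_def r_coset_def)
  have "?M +> f \<in> residue_constants R k P" if f: "f \<in> local_ring R P" for f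
  proof -
    obtain c where c: "c \<in> k" "f \<ominus> c \<in> ?M"
      using const[OF f] by blast
    have carr: "f \<in> carrier R" "c \<in> carrier R"
      using f c k sub by auto
    then have "f = (f \<ominus> c) \<oplus> c"
      by algebra
    then have "f \<in> ?M +>\<^bsub>?L\<^esub> c"
      using c by (auto simp: a_r_coset_def r_coset_def)
    then have "?M +>\<^bsub>?L\<^esub> f = ?M +>\<^bsub>?L\<^esub> c"
      using I.a_repr_independence' c k by auto
    then show ?thesis
      using c by (auto simp: coset residue_constants_def)
  qed
  moreover have "carrier (residue_field R P) = (\<lambda>f. ?M +>\<^bsub>?L\<^esub> f) ` local_ring R P"
    by (auto simp: residue_field_def FactRing_def A_RCOSETS_def')
  ultimately have "carrier (residue_field R P) = residue_constants R k P"
    using k by (auto simp: coset residue_constants_def)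
  then show ?thesis
    using P by (simp add: rational_points_def)
qed

end

section \<open>Torsion differences from functions with two-point divisors\<close>

context field
begin

lemma principal_divisors_subgroup: "subgroup (principal_divisors R k) (divisor_group R k)"
proof -
  let ?G = "divisor_group R k"
  interpret G: comm_group ?G
    unfolding divisor_group_def by (rule abelian_free_Abelian_group)
  have keys: "D \<in> carrier ?G \<longleftrightarrow> Poly_Mapping.keys D \<subseteq> closed_points R k" for D
    by (simp add: divisor_group_def)
  show ?thesis
  proof (rule G.subgroupI)
    show "principal_divisors R k \<subseteq> carrier ?G"
      by (auto simp: principal_divisors_def)
    have "0 \<in> principal_divisors R k"
      by (auto simp: principal_divisors_def keys closed_point_one intro!: bexI[of _ \<one>])
    then show "principal_divisors R k \<noteq> {}" by blast
  next
    fix D assume D: "D \<in> principal_divisors R k"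
    then obtain f where f: "f \<in> carrier R - {\<zero>}"
      "\<And>P. P \<in> closed_points R k \<Longrightarrow> Poly_Mapping.lookup D P = P f"
      and k: "Poly_Mapping.keys D \<subseteq> closed_points R k"
      by (auto simp: principal_divisors_def keys)
    have "- D \<in> principal_divisors R k"
      using f k nonzero_inv_closed[OF f(1)]
      by (auto simp: principal_divisors_def keys closed_point_inv intro!: bexI[of _ "inv f"])
    then show "inv\<^bsub>?G\<^esub> D \<in> principal_divisors R k"
      using k by (simp add: divisor_group_def)
  next
    fix D E assume D: "D \<in> principal_divisors R k" and E: "E \<in> principal_divisors R k"
    obtain f where f: "f \<in> carrier R - {\<zero>}"
      "\<And>P. P \<in> closed_points R k \<Longrightarrow> Poly_Mapping.lookup D P = P f"
      using D by (auto simp: principal_divisors_def)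
    obtain h where h: "h \<in> carrier R - {\<zero>}"
      "\<And>P. P \<in> closed_points R k \<Longrightarrow> Poly_Mapping.lookup E P = P h"
      using E by (auto simp: principal_divisors_def)
    have k: "Poly_Mapping.keys D \<subseteq> closed_points R k" "Poly_Mapping.keys E \<subseteq> closed_points R k"
      using D E by (auto simp: principal_divisors_def keys)
    have "Poly_Mapping.keys (D + E) \<subseteq> closed_points R k"
      using k Poly_Mapping.keys_add[of D E] by blast
    then have "D + E \<in> principal_divisors R k"
      using f h nonzero_mult_closed[OF f(1) h(1)]
      by (auto simp: principal_divisors_def keys lookup_add closed_point_mult
          intro!: bexI[of _ "f \<otimes> h"])
    then show "D \<otimes>\<^bsub>?G\<^esub> E \<in> principal_divisors R k"
      by (simp add: divisor_group_def)
  qed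
qed

lemma principal_divisors_diff:
  assumes "D \<in> principal_divisors R k" "E \<in> principal_divisors R k"
  shows "D - E \<in> principal_divisors R k"
proof -
  have "Poly_Mapping.keys E \<subseteq> closed_points R k"
    using assms by (simp add: principal_divisors_def divisor_group_def)
  then show ?thesis
    using subgroup.m_closed[OF principal_divisors_subgroup assms(1)
        subgroup.m_inv_closed[OF principal_divisors_subgroup assms(2)]]
    by (simp add: divisor_group_def)
qed

lemma principal_divisors_cmul:
  assumes "D \<in> principal_divisors R k"
  shows "frag_cmul (int n) D \<in> principal_divisors R k"
proof (induction n)
  case 0
  show ?case
    using subgroup.one_closed[OF principal_divisors_subgroup] by (simp add: divisor_group_def)
next
  case (Suc n)
  have "frag_cmul (int (Suc n)) D = frag_cmul (int n) D + D"
    by (simp add: frag_cmul_distrib)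
  then show ?case
    using subgroup.m_closed[OF principal_divisors_subgroup Suc.IH assms]
    by (simp add: divisor_group_def)
qed

text \<open>
  The group \<^const>\<open>Pic0\<close> carries the multiplication of the full class group, so its powers are computed
  there, where the class map is a homomorphism.
\<close>
lemma divisor_class_torsion:
  assumes D: "D \<in> carrier (divisor_group R k)" "divisor_degree R k D = 0"
    and n: "n \<ge> 1" "frag_cmul (int n) D \<in> principal_divisors R k"
  shows "divisor_class R k D \<in> torsion_elements (Pic0 R k)"
proof -
  let ?G = "divisor_group R k" and ?H = "principal_divisors R k"
  interpret G: comm_group ?G
    unfolding divisor_group_def by (rule abelian_free_Abelian_group)
  interpret H: normal ?H ?G
    by (rule G.subgroup_imp_normal[OF principal_divisors_subgroup])
  have pow: "divisor_class R k D [^]\<^bsub>Pic0 R k\<^esub> j = divisor_class R k (frag_cmul (int j) D)" for j :: nat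
  proof (induction j)
    case 0
    have "?H #>\<^bsub>?G\<^esub> \<one>\<^bsub>?G\<^esub> = ?H"
      by (rule G.coset_mult_one[OF H.subset])
    then show ?case
      by (simp add: Pic0_def FactGroup_def divisor_class_def divisor_group_def)
  next
    case (Suc j)
    have "frag_cmul (int j) D \<in> carrier ?G"
      using D(1) keys_cmul[of "int j" D] by (auto simp: divisor_group_def)
    then have "divisor_class R k (frag_cmul (int j) D) <#>\<^bsub>?G\<^esub> divisor_class R k D
        = divisor_class R k (frag_cmul (int j) D \<otimes>\<^bsub>?G\<^esub> D)"
      unfolding divisor_class_def using H.rcos_sum D(1) by blast
    moreover have "frag_cmul (int (Suc j)) D = frag_cmul (int j) D + D"
      by (simp add: frag_cmul_distrib)
    ultimately show ?case
      using Suc by (simp add: nat_pow_def) (simp add: Pic0_def FactGroup_def divisor_group_def)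
  qed
  have "divisor_class R k (frag_cmul (int n) D) = \<one>\<^bsub>Pic0 R k\<^esub>"
    using H.rcos_const[OF G.group_axioms n(2)]
    by (simp add: divisor_class_def Pic0_def FactGroup_def)
  moreover have "divisor_class R k D \<in> carrier (Pic0 R k)"
    using D by (auto simp: Pic0_def)
  ultimately show ?thesis
    using n(1) pow[of n] by (auto simp: torsion_elements_def intro!: exI[of _ n])
qed

lemma divisor_degree_difference:
  assumes "P \<in> rational_points R k" "Q \<in> rational_points R k"
  shows "divisor_degree R k (frag_of P - frag_of Q) = 0"
proof (cases "P = Q")
  case False
  then have "Poly_Mapping.keys (frag_of P - frag_of Q) = {P, Q}"
    by (auto simp: in_keys_iff lookup_minus lookup_frag_of)
  then show ?thesis
    using False assms
    by (simp add: divisor_degree_def lookup_minus lookup_frag_of rational_point_degree)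
qed (simp add: divisor_degree_def)

lemma two_point_divisor_principal:
  assumes f: "f \<in> carrier R - {\<zero>}"
    and P: "P \<in> closed_points R k" "P f = - int n"
    and Q: "Q \<in> closed_points R k" "Q f = int n" and "P \<noteq> Q"
    and other: "\<And>S. S \<in> closed_points R k \<Longrightarrow> S \<noteq> P \<Longrightarrow> S \<noteq> Q \<Longrightarrow> S f = 0"
  shows "frag_cmul (int n) (frag_of Q - frag_of P) \<in> principal_divisors R k"
proof -
  let ?D = "frag_cmul (int n) (frag_of Q - frag_of P)"
  have look: "Poly_Mapping.lookup ?D S = (if S = Q then int n else if S = P then - int n else 0)" for S
    using \<open>P \<noteq> Q\<close> by (auto simp: lookup_minus lookup_frag_of)
  have "Poly_Mapping.keys ?D \<subseteq> closed_points R k"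
    unfolding subset_iff in_keys_iff look using P(1) Q(1) by auto
  moreover have "Poly_Mapping.lookup ?D S = S f" if "S \<in> closed_points R k" for S
    unfolding look using that P(2) Q(2) other by auto
  ultimately show ?thesis
    using f unfolding principal_divisors_def divisor_group_def by auto
qed

text \<open>
  Torsion of the two differences with a common base point suffices: if \<open>i ((P) - (R\<^sub>1))\<close> is the divisor
  of \<open>u\<close> and \<open>j ((Q) - (R\<^sub>1))\<close> that of \<open>v\<close>, then \<open>u\<^sup>j / v\<^sup>i\<close> has divisor \<open>i j ((P) - (Q))\<close>.
\<close>
lemma defines_tame_K2_elementI:
  assumes rat: "R1 \<in> rational_points R k" "R2 \<in> rational_points R k" "R3 \<in> rational_points R k"
    and dist: "distinct [R1, R2, R3]"
    and n: "n \<ge> 1" "frag_cmul (int n) (frag_of R2 - frag_of R1) \<in> principal_divisors R k"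
    and m: "m \<ge> 1" "frag_cmul (int m) (frag_of R3 - frag_of R1) \<in> principal_divisors R k"
  shows "defines_tame_K2_element R k R1 R2 R3"
proof -
  have tors: "\<exists>j\<ge>1. frag_cmul (int j) (frag_of P - frag_of R1) \<in> principal_divisors R k"
    if "P \<in> {R1, R2, R3}" for P
  proof -
    have "0 \<in> principal_divisors R k"
      using subgroup.one_closed[OF principal_divisors_subgroup] by (simp add: divisor_group_def)
    then show ?thesis
      using that n m by auto
  qed
  have "divisor_class R k (frag_of P - frag_of Q) \<in> torsion_elements (Pic0 R k)"
    if PQ: "P \<in> {R1, R2, R3}" "Q \<in> {R1, R2, R3}" for P Q
  proof -
    obtain i j where i: "i \<ge> 1" "frag_cmul (int i) (frag_of P - frag_of R1) \<in> principal_divisors R k"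
      and j: "j \<ge> 1" "frag_cmul (int j) (frag_of Q - frag_of R1) \<in> principal_divisors R k"
      using tors PQ by meson
    have rPQ: "P \<in> rational_points R k" "Q \<in> rational_points R k"
      using PQ rat by auto
    have "frag_cmul (int (i * j)) (frag_of P - frag_of Q)
        = frag_cmul (int j) (frag_cmul (int i) (frag_of P - frag_of R1))
          - frag_cmul (int i) (frag_cmul (int j) (frag_of Q - frag_of R1))"
      by (rule poly_mapping_eqI) (simp add: lookup_minus algebra_simps)
    also have "\<dots> \<in> principal_divisors R k"
      by (intro principal_divisors_diff principal_divisors_cmul i j)
    finally have "frag_cmul (int (i * j)) (frag_of P - frag_of Q) \<in> principal_divisors R k" .
    moreover have "frag_of P - frag_of Q \<in> carrier (divisor_group R k)"
      using rPQ by (auto simp: divisor_group_def rational_points_def in_keys_iff lookup_minus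
          lookup_frag_of split: if_splits)
    moreover have "i * j \<ge> 1"
      using i(1) j(1) by (simp add: Suc_le_eq)
    ultimately show ?thesis
      using divisor_class_torsion[of _ k "i * j"] divisor_degree_difference[OF rPQ] by blast
  qed
  then show ?thesis
    using rat dist by (simp add: defines_tame_K2_element_def)
qed

end

section \<open>The closed point of a local parameter\<close>

text \<open>
  Here \<open>Z\<close> plays the role of a ring of functions regular at a point, \<open>ev\<close> of evaluation at that point,
  and \<open>t\<close> of a uniformizer. The ring \<open>Z\<close> need not be the local ring, nor even local: a coordinate ring
  will do. Negative exponents and quotients are avoided by writing \<open>t\<^sup>n B F = t\<^sup>m A\<close> for
  \<open>F = t\<^bsup>m-n\<^esup> A / B\<close>.
\<close>
locale local_parameter = field R for R (structure) +
  fixes Z :: "'a set" and ev :: "'a \<Rightarrow> 'c::field" and cst :: "'c \<Rightarrow> 'a" and t :: 'a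
  assumes Z_subring: "subring Z R"
    and ev_add: "A \<in> Z \<Longrightarrow> B \<in> Z \<Longrightarrow> ev (A \<oplus> B) = ev A + ev B"
    and ev_mult: "A \<in> Z \<Longrightarrow> B \<in> Z \<Longrightarrow> ev (A \<otimes> B) = ev A * ev B"
    and cst_mem: "cst c \<in> Z" and ev_cst: "ev (cst c) = c" and cst_zero: "cst 0 = \<zero>"
    and t_mem: "t \<in> Z" and t_nonzero: "t \<noteq> \<zero>" and ev_t: "ev t = 0"
    and expansion: "F \<in> carrier R - {\<zero>} \<Longrightarrow>
      \<exists>n m A B. A \<in> Z \<and> B \<in> Z \<and> ev A \<noteq> 0 \<and> ev B \<noteq> 0 \<and>
        t [^] (n::nat) \<otimes> B \<otimes> F = t [^] (m::nat) \<otimes> A"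
begin

lemma Z_carrier: "A \<in> Z \<Longrightarrow> A \<in> carrier R"
  using subringE(1)[OF Z_subring] by blast

lemmas Z_closed = subringE(2,3,5,6,7)[OF Z_subring]

lemma t_carrier: "t \<in> carrier R - {\<zero>}"
  using Z_carrier t_mem t_nonzero by blast

lemma t_pow_mem: "t [^] (n::nat) \<in> Z"
  by (induction n) (auto simp: Z_closed t_mem)

lemma ev_zero: "ev \<zero> = 0"
  using ev_cst[of 0] cst_zero by simp

lemma ev_one: "ev \<one> = 1"
proof -
  have "\<one> \<otimes> cst 1 = cst 1"
    using Z_carrier cst_mem by simp
  then show ?thesis
    using ev_mult[of \<one> "cst 1"] ev_cst[of 1] cst_mem Z_closed by simp
qed

lemma Z_diff: "A \<in> Z \<Longrightarrow> B \<in> Z \<Longrightarrow> A \<ominus> B \<in> Z"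
  by (simp add: a_minus_def Z_closed)

lemma ev_diff:
  assumes "A \<in> Z" "B \<in> Z"
  shows "ev (A \<ominus> B) = ev A - ev B"
proof -
  have "A \<ominus> B \<in> Z"
    by (rule Z_diff[OF assms])
  moreover have "A = (A \<ominus> B) \<oplus> B"
    using assms Z_carrier by algebra
  ultimately show ?thesis
    using ev_add[of "A \<ominus> B" B] assms by simp
qed

lemma ev_nonzero: "A \<in> Z \<Longrightarrow> ev A \<noteq> 0 \<Longrightarrow> A \<in> carrier R - {\<zero>}"
  using ev_zero Z_carrier by auto

lemma ev_t_pow: "n > 0 \<Longrightarrow> ev (t [^] (n::nat)) = 0"
  by (cases n) (auto simp: ev_mult t_pow_mem t_mem ev_t)

definition expands :: "'a \<Rightarrow> nat \<Rightarrow> nat \<Rightarrow> bool" where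
  "expands F n m \<longleftrightarrow> (\<exists>A B. A \<in> Z \<and> B \<in> Z \<and> ev A \<noteq> 0 \<and> ev B \<noteq> 0 \<and>
     t [^] n \<otimes> B \<otimes> F = t [^] m \<otimes> A)"

text \<open>
  After cancelling the smaller power of \<open>t\<close>, evaluation kills one side and not the other. This makes
  the exponent in an expansion well defined.
\<close>
lemma t_pow_cancel_le:
  assumes U: "U \<in> Z" "ev U \<noteq> 0" and V: "V \<in> Z"
    and eq: "t [^] i \<otimes> U = t [^] j \<otimes> V"
  shows "j \<le> (i::nat)"
proof (rule ccontr)
  assume "\<not> j \<le> i"
  then obtain d where j: "j = i + d" and d: "d > 0"
    by (metis add_diff_inverse_nat nat_le_linear not_le zero_less_diff)
  have carr: "U \<in> carrier R" "V \<in> carrier R" "t \<in> carrier R"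
    using U V Z_carrier t_carrier by auto
  have "t [^] i \<otimes> U = t [^] i \<otimes> (t [^] d \<otimes> V)"
    using eq carr by (simp add: j m_assoc flip: nat_pow_mult)
  then have "U = t [^] d \<otimes> V"
    using nonzero_pow_closed[OF t_carrier, of i] carr m_lcancel by auto
  then have "ev U = 0"
    using ev_mult[OF t_pow_mem V] ev_t_pow[OF d] by simp
  then show False using U by simp
qed

lemma expands_unique:
  assumes F: "F \<in> carrier R - {\<zero>}" and "expands F n m" "expands F n' m'"
  shows "int m - int n = int m' - int n'"
proof -
  obtain A B where AB: "A \<in> Z" "B \<in> Z" "ev A \<noteq> 0" "ev B \<noteq> 0" "t [^] n \<otimes> B \<otimes> F = t [^] m \<otimes> A"
    using assms(2) by (auto simp: expands_def)
  obtain A' B' where AB': "A' \<in> Z" "B' \<in> Z" "ev A' \<noteq> 0" "ev B' \<noteq> 0"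
      "t [^] n' \<otimes> B' \<otimes> F = t [^] m' \<otimes> A'"
    using assms(3) by (auto simp: expands_def)
  have carr: "A \<in> carrier R" "B \<in> carrier R" "A' \<in> carrier R" "B' \<in> carrier R"
      "t \<in> carrier R" "F \<in> carrier R"
    using AB AB' Z_carrier t_carrier F by auto
  have "(t [^] (n + m') \<otimes> (B \<otimes> A')) \<otimes> F = (t [^] n \<otimes> B \<otimes> F) \<otimes> (t [^] m' \<otimes> A')"
    using carr by (simp add: m_ac flip: nat_pow_mult)
  also have "\<dots> = (t [^] m \<otimes> A) \<otimes> (t [^] n' \<otimes> B' \<otimes> F)"
    using AB(5) AB'(5) by simp
  also have "\<dots> = (t [^] (m + n') \<otimes> (A \<otimes> B')) \<otimes> F"
    using carr by (simp add: m_ac flip: nat_pow_mult)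
  finally have eq: "t [^] (n + m') \<otimes> (B \<otimes> A') = t [^] (m + n') \<otimes> (A \<otimes> B')"
    using carr F m_rcancel by auto
  have U: "B \<otimes> A' \<in> Z" "ev (B \<otimes> A') \<noteq> 0" "A \<otimes> B' \<in> Z" "ev (A \<otimes> B') \<noteq> 0"
    using AB AB' by (auto simp: Z_closed ev_mult)
  have "n + m' = m + n'"
    using t_pow_cancel_le[OF U(1,2,3) eq] t_pow_cancel_le[OF U(3,4,1) eq[symmetric]] by simp
  then show ?thesis by simp
qed

definition vanishing_order :: "'a \<Rightarrow> int" where
  "vanishing_order F = (THE d. \<exists>n m. expands F n m \<and> d = int m - int n)"

lemma vanishing_orderI:
  assumes "F \<in> carrier R - {\<zero>}" "expands F n m"
  shows "vanishing_order F = int m - int n"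
  unfolding vanishing_order_def
  by (rule the_equality) (use assms expands_unique in blast)+

lemma expands_exists: "F \<in> carrier R - {\<zero>} \<Longrightarrow> \<exists>n m. expands F n m"
  unfolding expands_def using expansion by blast

lemma vanishing_order_mult:
  assumes F: "F \<in> carrier R - {\<zero>}" and H: "H \<in> carrier R - {\<zero>}"
  shows "vanishing_order (F \<otimes> H) = vanishing_order F + vanishing_order H"
proof -
  obtain n m n' m' where ex: "expands F n m" "expands H n' m'"
    using expands_exists F H by meson
  obtain A B where AB: "A \<in> Z" "B \<in> Z" "ev A \<noteq> 0" "ev B \<noteq> 0" "t [^] n \<otimes> B \<otimes> F = t [^] m \<otimes> A"
    using ex(1) by (auto simp: expands_def)
  obtain A' B' where AB': "A' \<in> Z" "B' \<in> Z" "ev A' \<noteq> 0" "ev B' \<noteq> 0"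
      "t [^] n' \<otimes> B' \<otimes> H = t [^] m' \<otimes> A'"
    using ex(2) by (auto simp: expands_def)
  have carr: "A \<in> carrier R" "B \<in> carrier R" "A' \<in> carrier R" "B' \<in> carrier R"
      "t \<in> carrier R" "F \<in> carrier R" "H \<in> carrier R"
    using AB AB' Z_carrier t_carrier F H by auto
  have "t [^] (n + n') \<otimes> (B \<otimes> B') \<otimes> (F \<otimes> H) = (t [^] n \<otimes> B \<otimes> F) \<otimes> (t [^] n' \<otimes> B' \<otimes> H)"
    using carr by (simp add: m_ac flip: nat_pow_mult)
  also have "\<dots> = t [^] (m + m') \<otimes> (A \<otimes> A')"
    unfolding AB(5) AB'(5) using carr by (simp add: m_ac flip: nat_pow_mult)
  finally have "expands (F \<otimes> H) (n + n') (m + m')"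
    unfolding expands_def using AB AB'
    by (intro exI[of _ "A \<otimes> A'"] exI[of _ "B \<otimes> B'"]) (simp add: Z_closed ev_mult)
  then show ?thesis
    using vanishing_orderI[OF F ex(1)] vanishing_orderI[OF H ex(2)]
      vanishing_orderI[OF nonzero_mult_closed[OF F H]] by simp
qed

lemma vanishing_order_t: "vanishing_order t = 1"
proof -
  have "expands t 0 1"
    unfolding expands_def using t_carrier
    by (intro exI[of _ \<one>]) (simp add: Z_closed ev_one)
  then show ?thesis using vanishing_orderI[OF t_carrier] by fastforce
qed

lemma vanishing_order_unit:
  assumes "A \<in> Z" "ev A \<noteq> 0"
  shows "vanishing_order A = 0"
proof -
  have "expands A 0 0"
    unfolding expands_def using assms Z_carrier
    by (intro exI[of _ A] exI[of _ \<one>]) (simp add: Z_closed ev_one)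
  then show ?thesis using vanishing_orderI ev_nonzero[OF assms] by fastforce
qed

lemma vanishing_order_t_pow: "vanishing_order (t [^] (n::nat)) = int n"
proof (induction n)
  case 0
  show ?case using vanishing_order_unit[of \<one>] by (simp add: Z_closed ev_one)
next
  case (Suc n)
  then show ?case
    using vanishing_order_mult[OF nonzero_pow_closed[OF t_carrier] t_carrier, of n]
    by (simp add: vanishing_order_t)
qed

lemma vanishing_order_Z:
  assumes C: "C \<in> Z" "C \<noteq> \<zero>"
  shows "0 \<le> vanishing_order C" and "ev C = 0 \<Longrightarrow> 0 < vanishing_order C"
proof -
  have Cc: "C \<in> carrier R - {\<zero>}" using C Z_carrier by auto
  obtain n m where ex: "expands C n m"
    using expands_exists Cc by blast
  then obtain A B where AB: "A \<in> Z" "B \<in> Z" "ev A \<noteq> 0" "ev B \<noteq> 0" "t [^] n \<otimes> B \<otimes> C = t [^] m \<otimes> A"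
    by (auto simp: expands_def)
  have carr: "A \<in> carrier R" "B \<in> carrier R" "C \<in> carrier R" "t \<in> carrier R"
    using AB C Z_carrier t_carrier by auto
  have eq: "t [^] m \<otimes> A = t [^] n \<otimes> (B \<otimes> C)"
    using AB(5) carr by (simp add: m_assoc)
  have BC: "B \<otimes> C \<in> Z"
    using AB C by (simp add: Z_closed)
  have le: "n \<le> m"
    by (rule t_pow_cancel_le[OF AB(1,3) BC eq])
  then show "0 \<le> vanishing_order C"
    using vanishing_orderI[OF Cc ex] by simp
  show "0 < vanishing_order C" if ev: "ev C = 0"
  proof -
    have "n \<noteq> m"
    proof
      assume "n = m"
      then have "A = B \<otimes> C"
        using eq nonzero_pow_closed[OF t_carrier, of m] carr m_lcancel by auto
      then show False
        using AB ev ev_mult C by auto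
    qed
    then show ?thesis
      using le vanishing_orderI[OF Cc ex] by simp
  qed
qed

text \<open>
  Over the common denominator, the power of \<open>t\<close> belonging to \<open>F\<close> can be taken out of the sum; the
  cofactor \<open>C\<close> lies in \<open>Z\<close>, where orders are nonnegative.
\<close>
lemma vanishing_order_add_le:
  assumes F: "F \<in> carrier R - {\<zero>}" and H: "H \<in> carrier R - {\<zero>}" and FH: "F \<oplus> H \<noteq> \<zero>"
    and le: "vanishing_order F \<le> vanishing_order H"
  shows "vanishing_order F \<le> vanishing_order (F \<oplus> H)"
proof -
  obtain n m n' m' where ex: "expands F n m" "expands H n' m'"
    using expands_exists F H by meson
  obtain A B where AB: "A \<in> Z" "B \<in> Z" "ev A \<noteq> 0" "ev B \<noteq> 0" "t [^] n \<otimes> B \<otimes> F = t [^] m \<otimes> A"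
    using ex(1) by (auto simp: expands_def)
  obtain A' B' where AB': "A' \<in> Z" "B' \<in> Z" "ev A' \<noteq> 0" "ev B' \<noteq> 0"
      "t [^] n' \<otimes> B' \<otimes> H = t [^] m' \<otimes> A'"
    using ex(2) by (auto simp: expands_def)
  have carr: "A \<in> carrier R" "B \<in> carrier R" "A' \<in> carrier R" "B' \<in> carrier R"
      "t \<in> carrier R" "F \<in> carrier R" "H \<in> carrier R"
    using AB AB' Z_carrier t_carrier F H by auto
  have oF: "vanishing_order F = int m - int n" and oH: "vanishing_order H = int m' - int n'"
    using vanishing_orderI F H ex by auto
  obtain d where d: "n + m' = n' + m + d"
    using le oF oH le_Suc_ex[of "n' + m" "n + m'"] by auto
  define C where "C = A \<otimes> B' \<oplus> t [^] d \<otimes> (A' \<otimes> B)"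
  have CZ: "C \<in> Z"
    unfolding C_def using AB AB' t_pow_mem by (simp add: Z_closed)
  have "(t [^] (n + n') \<otimes> (B \<otimes> B')) \<otimes> (F \<oplus> H)
      = t [^] n' \<otimes> B' \<otimes> (t [^] n \<otimes> B \<otimes> F) \<oplus> t [^] n \<otimes> B \<otimes> (t [^] n' \<otimes> B' \<otimes> H)"
    using carr by (simp add: r_distr m_ac flip: nat_pow_mult)
  also have "\<dots> = t [^] (n' + m) \<otimes> (A \<otimes> B') \<oplus> t [^] (n + m') \<otimes> (A' \<otimes> B)"
    unfolding AB(5) AB'(5) using carr by (simp add: m_ac flip: nat_pow_mult)
  also have "\<dots> = t [^] (n' + m) \<otimes> C"
    unfolding C_def d using carr by (simp add: r_distr m_ac flip: nat_pow_mult)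
  finally have eq: "(t [^] (n + n') \<otimes> (B \<otimes> B')) \<otimes> (F \<oplus> H) = t [^] (n' + m) \<otimes> C" .
  have BB: "B \<otimes> B' \<in> Z" "ev (B \<otimes> B') \<noteq> 0"
    using AB AB' by (auto simp: Z_closed ev_mult)
  note nzBB = ev_nonzero[OF BB] and nzt = nonzero_pow_closed[OF t_carrier]
  have FH': "F \<oplus> H \<in> carrier R - {\<zero>}" using F H FH by auto
  have "(t [^] (n + n') \<otimes> (B \<otimes> B')) \<otimes> (F \<oplus> H) \<noteq> \<zero>"
    using nonzero_mult_closed[OF nonzero_mult_closed[OF nzt[of "n + n'"] nzBB] FH'] by blast
  then have Cnz: "C \<noteq> \<zero>"
    using eq carr by auto
  have "int (n + n') + vanishing_order (F \<oplus> H) = int (n' + m) + vanishing_order C"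
    using arg_cong[OF eq, of vanishing_order] vanishing_order_mult nzBB nzt FH'
      nonzero_mult_closed CZ Cnz Z_carrier vanishing_order_t_pow vanishing_order_unit[OF BB]
    by auto
  then show ?thesis
    using oF vanishing_order_Z(1)[OF CZ Cnz] by simp
qed

definition param_point :: "'a \<Rightarrow> int" where
  "param_point = restrict vanishing_order (carrier R - {\<zero>})"

lemma param_point_eq: "F \<in> carrier R - {\<zero>} \<Longrightarrow> param_point F = vanishing_order F"
  by (simp add: param_point_def)

lemma param_point_closed_point: "param_point \<in> closed_points R (range cst)"
proof -
  have pw: "\<exists>F \<in> carrier R - {\<zero>}. param_point F = d" for d
  proof (cases "d \<ge> 0")
    case True
    then show ?thesis
      using vanishing_order_t_pow[of "nat d"] nonzero_pow_closed[OF t_carrier, of "nat d"]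
      by (intro bexI[of _ "t [^] nat d"]) (simp_all add: param_point_eq)
  next
    case False
    let ?T = "t [^] nat (- d)"
    have T: "?T \<in> carrier R - {\<zero>}" by (rule nonzero_pow_closed[OF t_carrier])
    have "?T \<otimes> inv ?T = \<one>"
      using T field_Units by auto
    then have "int (nat (- d)) + vanishing_order (inv ?T) = 0"
      using vanishing_order_mult[OF T nonzero_inv_closed[OF T]] vanishing_order_t_pow
        vanishing_order_unit[of \<one>] by (simp add: Z_closed ev_one)
    then show ?thesis
      using False nonzero_inv_closed[OF T]
      by (intro bexI[of _ "inv ?T"]) (simp_all add: param_point_eq)
  qed
  have add: "min (param_point F) (param_point H) \<le> param_point (F \<oplus> H)"
    if FH: "F \<in> carrier R - {\<zero>}" "H \<in> carrier R - {\<zero>}" "F \<oplus> H \<noteq> \<zero>" for F H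
  proof -
    have "F \<oplus> H \<in> carrier R - {\<zero>}" using FH by auto
    moreover have "F \<oplus> H = H \<oplus> F" using FH by (auto simp: a_comm)
    ultimately show ?thesis
      using FH vanishing_order_add_le[of F H] vanishing_order_add_le[of H F]
      by (cases "vanishing_order F \<le> vanishing_order H") (auto simp: param_point_eq min_def)
  qed
  have const: "param_point c = 0" if "c \<in> range cst - {\<zero>}" for c
    using that cst_zero vanishing_order_unit[OF cst_mem] ev_cst cst_mem Z_carrier
    by (auto simp: param_point_eq) metis
  have "param_point ` (carrier R - {\<zero>}) = UNIV"
    using pw by (metis UNIV_eq_I imageI)
  then show ?thesis
    unfolding closed_points_def
    using add const by (auto simp: param_point_def vanishing_order_mult integral_iff)
qed

lemma param_point_Z: "Z \<subseteq> local_ring R param_point"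
proof
  fix A assume A: "A \<in> Z"
  then show "A \<in> local_ring R param_point"
    using vanishing_order_Z(1)[of A] Z_carrier[of A] param_point_eq[of A]
    by (cases "A = \<zero>") (auto simp: local_ring_def)
qed

lemma param_point_vanishing: "A \<in> Z \<Longrightarrow> ev A = 0 \<Longrightarrow> A \<in> local_maximal_ideal R param_point"
  using vanishing_order_Z(2)[of A] Z_carrier[of A] param_point_eq[of A]
  by (cases "A = \<zero>") (auto simp: local_maximal_ideal_def)

text \<open>
  A function \<open>A\<close> of \<open>Z\<close> with nonzero value differs from the constant \<open>ev A\<close> by a function in the maximal
  ideal, so \<open>P A = 0\<close>. Expanding an arbitrary \<open>F\<close> gives \<open>P F = n (P t)\<close> with \<open>n\<close> the vanishing order,
  and \<open>P t = 1\<close> since \<open>P\<close> is surjective and \<open>P t > 0\<close>.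
\<close>
lemma param_point_unique:
  assumes P: "P \<in> closed_points R (range cst)"
    and vanish: "\<And>A. A \<in> Z \<Longrightarrow> ev A = 0 \<Longrightarrow> A \<in> local_maximal_ideal R P"
  shows "P = param_point"
proof -
  have unit: "P A = 0" if A: "A \<in> Z" "ev A \<noteq> 0" for A
  proof (rule ccontr)
    assume nz: "P A \<noteq> 0"
    let ?c = "cst (ev A)"
    have c: "?c \<in> Z" "ev ?c = ev A" by (auto simp: cst_mem ev_cst)
    then have Pc: "P ?c = 0" "?c \<in> carrier R - {\<zero>}"
      using closed_point_const[OF P, of ?c] ev_nonzero[of ?c] A by auto
    have M: "A \<ominus> ?c \<in> local_maximal_ideal R P" "?c \<ominus> A \<in> local_maximal_ideal R P"
      using A c by (simp_all add: vanish Z_diff ev_diff)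
    have "A = (A \<ominus> ?c) \<oplus> ?c"
      using A c Z_carrier by algebra
    moreover have "?c \<in> local_ring R P"
      using Pc by (auto simp: local_ring_def)
    ultimately have "A \<in> local_ring R P"
      using subringE(7)[OF local_ring_subring[OF P]] M(1) local_maximal_ideal_subset[OF P]
      by (metis subsetD)
    then have "A \<in> local_maximal_ideal R P"
      using nz ev_nonzero[OF A] by (auto simp: local_ring_def local_maximal_ideal_def)
    then have "(?c \<ominus> A) \<oplus> A \<in> local_maximal_ideal R P"
      using M(2) local_maximal_ideal_add[OF P] by blast
    moreover have "(?c \<ominus> A) \<oplus> A = ?c"
      using A c Z_carrier by algebra
    ultimately show False
      using Pc by (auto simp: local_maximal_ideal_def)
  qed
  have eq: "P F = vanishing_order F * P t" if F: "F \<in> carrier R - {\<zero>}" for F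
  proof -
    obtain n m where ex: "expands F n m" using expands_exists F by blast
    then obtain A B where AB: "A \<in> Z" "B \<in> Z" "ev A \<noteq> 0" "ev B \<noteq> 0"
        "t [^] n \<otimes> B \<otimes> F = t [^] m \<otimes> A"
      by (auto simp: expands_def)
    note nzt = nonzero_pow_closed[OF t_carrier] and nz = ev_nonzero[OF AB(1,3)] ev_nonzero[OF AB(2,4)]
    have "P (t [^] n \<otimes> B \<otimes> F) = int n * P t + P F"
      using closed_point_mult[OF P nonzero_mult_closed[OF nzt nz(2)] F, of n]
        closed_point_mult[OF P nzt nz(2), of n] closed_point_pow[OF P t_carrier, of n]
        unit[OF AB(2,4)] by simp
    moreover have "P (t [^] m \<otimes> A) = int m * P t"
      using closed_point_mult[OF P nzt nz(1), of m] closed_point_pow[OF P t_carrier, of m]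
        unit[OF AB(1,3)] by simp
    ultimately have "int m * P t = int n * P t + P F"
      using AB(5) by simp
    then show ?thesis
      unfolding vanishing_orderI[OF F ex] by (simp add: algebra_simps)
  qed
  have "P t > 0"
    using vanish[OF t_mem ev_t] t_nonzero by (auto simp: local_maximal_ideal_def)
  moreover obtain F where "F \<in> carrier R - {\<zero>}" "P F = 1"
    using closed_point_surj[OF P] by blast
  ultimately have "P t = 1"
    using eq[of F] by (metis zmult_eq_1_iff mult.commute neg_0_less_iff_less not_one_less_zero)
  then have "P F = param_point F" if "F \<in> carrier R - {\<zero>}" for F
    using eq that by (simp add: param_point_eq)
  moreover have "P \<in> extensional (carrier R - {\<zero>})" "param_point \<in> extensional (carrier R - {\<zero>})"
    using P by (auto simp: closed_points_def param_point_def)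
  ultimately show ?thesis
    by (intro extensionalityI) auto
qed

text \<open>A function \<open>A / B\<close> of order 0 is congruent to the constant \<open>ev A / ev B\<close>.\<close>
lemma param_point_rational: "param_point \<in> rational_points R (range cst)"
proof (rule rational_pointI[OF param_point_closed_point])
  show "range cst \<subseteq> local_ring R param_point"
    using param_point_Z cst_mem by blast
next
  note P = param_point_closed_point
  fix F assume F: "F \<in> local_ring R param_point"
  show "\<exists>c \<in> range cst. F \<ominus> c \<in> local_maximal_ideal R param_point"
  proof (cases "F \<in> local_maximal_ideal R param_point")
    case True
    then have "F \<ominus> cst 0 \<in> local_maximal_ideal R param_point"
      using cst_zero by (simp add: local_maximal_ideal_def a_minus_def)
    then show ?thesis by blast
  next
    case False
    then have Fc: "F \<in> carrier R - {\<zero>}" and F0: "vanishing_order F = 0"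
      using F by (auto simp: local_ring_def local_maximal_ideal_def param_point_eq)
    obtain n m where ex: "expands F n m" using expands_exists Fc by blast
    then obtain A B where AB: "A \<in> Z" "B \<in> Z" "ev A \<noteq> 0" "ev B \<noteq> 0"
        "t [^] n \<otimes> B \<otimes> F = t [^] m \<otimes> A"
      by (auto simp: expands_def)
    have "n = m" using vanishing_orderI[OF Fc ex] F0 by simp
    have carr: "A \<in> carrier R" "B \<in> carrier R" "F \<in> carrier R" "t \<in> carrier R"
      using AB Z_carrier Fc t_carrier by auto
    have "t [^] m \<otimes> (B \<otimes> F) = t [^] m \<otimes> A"
      using AB(5) carr by (simp add: \<open>n = m\<close> m_assoc)
    then have BF: "B \<otimes> F = A"
      using nonzero_pow_closed[OF t_carrier, of m] carr m_lcancel by auto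
    define c where "c = cst (ev A / ev B)"
    have c: "c \<in> Z" "c \<in> carrier R" "ev c = ev A / ev B"
      using cst_mem Z_carrier by (auto simp: c_def ev_cst)
    have "B \<otimes> (F \<ominus> c) = B \<otimes> F \<ominus> B \<otimes> c"
      using carr c by algebra
    then have "B \<otimes> (F \<ominus> c) = A \<ominus> B \<otimes> c"
      by (simp add: BF)
    moreover have "A \<ominus> B \<otimes> c \<in> local_maximal_ideal R param_point"
    proof (rule param_point_vanishing)
      show "A \<ominus> B \<otimes> c \<in> Z"
        using AB c by (simp add: a_minus_def Z_closed)
      show "ev (A \<ominus> B \<otimes> c) = 0"
        using AB c by (simp add: ev_diff ev_mult Z_closed)
    qed
    moreover have "inv B \<in> local_ring R param_point"
      using closed_point_inv[OF P ev_nonzero[OF AB(2,4)]] vanishing_order_unit[OF AB(2,4)]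
        nonzero_inv_closed[OF ev_nonzero[OF AB(2,4)]] ev_nonzero[OF AB(2,4)]
      by (auto simp: local_ring_def param_point_eq)
    ultimately have "inv B \<otimes> (B \<otimes> (F \<ominus> c)) \<in> local_maximal_ideal R param_point"
      using local_maximal_ideal_mult[OF P] by metis
    moreover have "inv B \<otimes> (B \<otimes> (F \<ominus> c)) = F \<ominus> c"
      using ev_nonzero[OF AB(2,4)] nonzero_inv_closed[OF ev_nonzero[OF AB(2,4)]] carr c field_Units
      by (simp flip: m_assoc)
    ultimately show ?thesis
      by (auto simp: c_def)
  qed
qed

lemma param_point_t: "param_point t = 1"
  using t_carrier by (simp add: param_point_eq vanishing_order_t)

end

section \<open>Smooth points of a curve \<open>Y\<^sup>2 + F(X) Y + H(X) = 0\<close>\<close>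

lemma split_common_power_of_x:
  fixes p q :: "'c::field poly"
  assumes "p \<noteq> 0 \<or> q \<noteq> 0"
  shows "\<exists>a p0 q0. p = [:0, 1:] ^ a * p0 \<and> q = [:0, 1:] ^ a * q0 \<and> (poly p0 0 \<noteq> 0 \<or> poly q0 0 \<noteq> 0)"
  using assms
proof (induction "degree p + degree q" arbitrary: p q rule: less_induct)
  case less
  show ?case
  proof (cases "poly p 0 \<noteq> 0 \<or> poly q 0 \<noteq> 0")
    case True
    show ?thesis
      by (rule exI[of _ 0], rule exI[of _ p], rule exI[of _ q]) (use True in simp)
  next
    case False
    obtain c p' where p: "p = pCons c p'" by (rule pCons_cases)
    obtain d q' where q: "q = pCons d q'" by (rule pCons_cases)
    have cd: "c = 0" "d = 0" using False p q by auto
    have "degree p' + degree q' < degree p + degree q" "p' \<noteq> 0 \<or> q' \<noteq> 0"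
      using less.prems p q cd by auto
    from less.hyps[OF this] obtain a p0 q0 where a: "p' = [:0, 1:] ^ a * p0"
        "q' = [:0, 1:] ^ a * q0" "poly p0 0 \<noteq> 0 \<or> poly q0 0 \<noteq> 0"
      by (elim exE conjE)
    show ?thesis
      by (rule exI[of _ "Suc a"], rule exI[of _ p0], rule exI[of _ q0])
        (use p q cd a in simp)
  qed
qed

text \<open>
  \<open>affine_fn p q\<close> stands for the function \<open>p(X) + q(X) Y\<close>. The rules for sums and products, together with
  \<open>affine_fn_zeroD\<close>, say that these functions form a copy of
  \<open>k[X, Y] / (Y\<^sup>2 + F(X) Y + H(X))\<close>, and \<open>affine_fn_gen\<close> says that the field consists of their quotients.
  Since \<open>H(0) = 0\<close>, the origin lies on the model, and \<open>smooth\<close> is the Jacobian criterion there.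
\<close>
locale affine_model = field R for R (structure) +
  fixes affine_fn :: "'c::field poly \<Rightarrow> 'c poly \<Rightarrow> 'a" and F H :: "'c poly"
  assumes affine_fn_closed: "affine_fn p q \<in> carrier R"
    and affine_fn_add: "affine_fn p q \<oplus> affine_fn p' q' = affine_fn (p + p') (q + q')"
    and affine_fn_mult: "affine_fn p q \<otimes> affine_fn p' q' = affine_fn (p * p' - q * q' * H) (p * q' + q * p' - q * q' * F)"
    and affine_fn_one: "affine_fn 1 0 = \<one>"
    and affine_fn_zeroD: "affine_fn p q = \<zero> \<Longrightarrow> p = 0 \<and> q = 0"
    and affine_fn_gen: "f \<in> carrier R \<Longrightarrow> \<exists>d p q. d \<noteq> 0 \<and> affine_fn d 0 \<otimes> f = affine_fn p q"
    and H_0: "poly H 0 = 0"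
    and smooth: "poly F 0 \<noteq> 0 \<or> coeff H 1 \<noteq> 0"
begin

abbreviation X where "X \<equiv> affine_fn [:0, 1:] 0"
abbreviation Y where "Y \<equiv> affine_fn 0 1"
abbreviation cst where "cst c \<equiv> affine_fn [:c:] 0"

definition Z :: "'a set" where "Z = {affine_fn p q | p q. True}"

text \<open>
  Evaluation at the origin, where \<open>Y\<close> vanishes. The choice of \<open>p\<close> is legitimate because a function
  determines its coefficients \<open>p\<close> and \<open>q\<close>.
\<close>
definition ev :: "'a \<Rightarrow> 'c" where "ev A = poly (THE p. \<exists>q. A = affine_fn p q) 0"

lemma affine_fn_zero: "affine_fn 0 0 = \<zero>"
proof -
  have "affine_fn 0 0 \<oplus> affine_fn 0 0 = affine_fn 0 0"
    by (simp add: affine_fn_add)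
  then show ?thesis using affine_fn_closed add.l_cancel_one by blast
qed

lemma affine_fn_minus: "\<ominus> affine_fn p q = affine_fn (- p) (- q)"
  by (rule minus_equality) (simp_all add: affine_fn_closed affine_fn_add affine_fn_zero)

lemma affine_fn_eq_iff: "affine_fn p q = affine_fn p' q' \<longleftrightarrow> p = p' \<and> q = q'"
proof
  assume "affine_fn p q = affine_fn p' q'"
  then have "affine_fn p q \<oplus> \<ominus> affine_fn p' q' = \<zero>"
    using affine_fn_closed by (simp add: r_neg)
  then have "affine_fn (p - p') (q - q') = \<zero>"
    by (simp add: affine_fn_minus affine_fn_add)
  then show "p = p' \<and> q = q'"
    using affine_fn_zeroD[of "p - p'" "q - q'"] by simp
qed simp

lemma affine_fn_nonzero: "p \<noteq> 0 \<or> q \<noteq> 0 \<Longrightarrow> affine_fn p q \<in> carrier R - {\<zero>}"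
  using affine_fn_zeroD[of p q] affine_fn_closed by auto

lemma affine_fn_in_Z: "affine_fn p q \<in> Z"
  by (auto simp: Z_def)

lemma Z_carrier: "A \<in> Z \<Longrightarrow> A \<in> carrier R"
  using affine_fn_closed by (auto simp: Z_def)

lemma Z_cases: "A \<in> Z \<Longrightarrow> (\<And>p q. A = affine_fn p q \<Longrightarrow> thesis) \<Longrightarrow> thesis"
  by (auto simp: Z_def)

lemma ev_affine_fn: "ev (affine_fn p q) = poly p 0"
  by (simp add: ev_def affine_fn_eq_iff)

lemma affine_fn_pow_mem: "affine_fn p q [^] (n::nat) \<in> Z"
proof (induction n)
  case 0
  show ?case using affine_fn_in_Z[of 1 0] affine_fn_one by simp
next
  case (Suc n)
  obtain p' q' where "affine_fn p q [^] n = affine_fn p' q'"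
    using Suc by (rule Z_cases)
  then show ?case
    by (simp add: affine_fn_in_Z affine_fn_mult)
qed

lemma ev_affine_fn_pow: "ev (affine_fn p q [^] (n::nat)) = poly p 0 ^ n"
proof (induction n)
  case 0
  show ?case using ev_affine_fn[of 1 0] affine_fn_one by simp
next
  case (Suc n)
  obtain p' q' where "affine_fn p q [^] n = affine_fn p' q'"
    using affine_fn_pow_mem by (rule Z_cases)
  then show ?case
    using Suc by (simp add: affine_fn_mult ev_affine_fn H_0)
qed

lemma X_pow: "X [^] (n::nat) = affine_fn ([:0, 1:] ^ n) 0"
  by (induction n) (simp_all add: affine_fn_one affine_fn_mult mult.commute)

lemma ring_data:
  shows "subring Z R"
    and "A \<in> Z \<Longrightarrow> B \<in> Z \<Longrightarrow> ev (A \<oplus> B) = ev A + ev B"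
    and "A \<in> Z \<Longrightarrow> B \<in> Z \<Longrightarrow> ev (A \<otimes> B) = ev A * ev B"
    and "cst c \<in> Z" and "ev (cst c) = c" and "cst 0 = \<zero>"
proof -
  show "subring Z R"
  proof (rule subringI)
    show "\<one> \<in> Z" using affine_fn_in_Z[of 1 0] affine_fn_one by simp
    show "\<ominus> A \<in> Z" if "A \<in> Z" for A
      using that by (elim Z_cases) (simp add: affine_fn_in_Z affine_fn_minus)
    show "A \<otimes> B \<in> Z" if "A \<in> Z" "B \<in> Z" for A B
      using that by (elim Z_cases) (simp add: affine_fn_in_Z affine_fn_mult)
    show "A \<oplus> B \<in> Z" if "A \<in> Z" "B \<in> Z" for A B
      using that by (elim Z_cases) (simp add: affine_fn_in_Z affine_fn_add)
  qed (auto elim!: Z_cases simp: affine_fn_closed)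
  show "ev (A \<oplus> B) = ev A + ev B" if "A \<in> Z" "B \<in> Z"
    using that by (elim Z_cases) (simp add: affine_fn_in_Z affine_fn_add ev_affine_fn)
  show "ev (A \<otimes> B) = ev A * ev B" if "A \<in> Z" "B \<in> Z"
    using that by (elim Z_cases) (simp add: affine_fn_in_Z affine_fn_mult ev_affine_fn H_0)
qed (auto simp: affine_fn_in_Z ev_affine_fn affine_fn_zero)

definition splits :: "'a \<Rightarrow> 'a \<Rightarrow> bool" where
  "splits t f \<longleftrightarrow> (\<exists>m A B. A \<in> Z \<and> B \<in> Z \<and> ev A \<noteq> 0 \<and> ev B \<noteq> 0 \<and> B \<otimes> f = t [^] (m::nat) \<otimes> A)"

lemma splitsI:
  "A \<in> Z \<Longrightarrow> B \<in> Z \<Longrightarrow> ev A \<noteq> 0 \<Longrightarrow> ev B \<noteq> 0 \<Longrightarrow> B \<otimes> f = t [^] (m::nat) \<otimes> A \<Longrightarrow> splits t f"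
  unfolding splits_def by (intro exI conjI)

lemma splitsE:
  assumes "splits t f"
  obtains m A B where "A \<in> Z" "B \<in> Z" "ev A \<noteq> 0" "ev B \<noteq> 0" "B \<otimes> f = t [^] (m::nat) \<otimes> A"
  using assms unfolding splits_def by (elim exE conjE) (rule that)

text \<open>Quotients of functions that split into a power of \<open>t\<close> and a unit do so as well.\<close>
lemma local_parameterI:
  assumes t: "t = affine_fn a b" "a \<noteq> 0 \<or> b \<noteq> 0" "poly a 0 = 0"
    and ex: "\<And>p q. p \<noteq> 0 \<or> q \<noteq> 0 \<Longrightarrow> splits t (affine_fn p q)"
  shows "local_parameter R Z ev cst t"
proof -
  have "\<exists>n m A B. A \<in> Z \<and> B \<in> Z \<and> ev A \<noteq> 0 \<and> ev B \<noteq> 0 \<and>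
        t [^] (n::nat) \<otimes> B \<otimes> f = t [^] (m::nat) \<otimes> A" if f: "f \<in> carrier R - {\<zero>}" for f
  proof -
    obtain d p q where d: "d \<noteq> 0" "affine_fn d 0 \<otimes> f = affine_fn p q"
      using affine_fn_gen f by blast
    have "affine_fn d 0 \<otimes> f \<noteq> \<zero>"
      using nonzero_mult_closed[OF affine_fn_nonzero f, of d 0] d(1) by blast
    then have "p \<noteq> 0 \<or> q \<noteq> 0"
      using affine_fn_zero d(2) by auto
    then have "splits t (affine_fn p q)"
      by (rule ex)
    then obtain m A B where AB: "A \<in> Z" "B \<in> Z" "ev A \<noteq> 0" "ev B \<noteq> 0"
        "B \<otimes> affine_fn p q = t [^] (m::nat) \<otimes> A"
      by (rule splitsE)
    have "splits t (affine_fn d 0)"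
      using ex d(1) by blast
    then obtain n A' B' where AB': "A' \<in> Z" "B' \<in> Z" "ev A' \<noteq> 0" "ev B' \<noteq> 0"
        "B' \<otimes> affine_fn d 0 = t [^] (n::nat) \<otimes> A'"
      by (rule splitsE)
    have carr: "A \<in> carrier R" "B \<in> carrier R" "A' \<in> carrier R" "B' \<in> carrier R" "t \<in> carrier R"
        "affine_fn p q \<in> carrier R" "affine_fn d 0 \<in> carrier R" "f \<in> carrier R"
      using AB(1,2) AB'(1,2) t(1) f affine_fn_closed Z_carrier by simp_all
    have "t [^] n \<otimes> (A' \<otimes> B) \<otimes> f = B \<otimes> (t [^] n \<otimes> A' \<otimes> f)"
      using carr by (simp add: m_ac)
    also have "\<dots> = B' \<otimes> (B \<otimes> (affine_fn d 0 \<otimes> f))"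
      unfolding AB'(5)[symmetric] using carr by (simp add: m_ac)
    also have "\<dots> = B' \<otimes> (t [^] m \<otimes> A)"
      by (simp add: d(2) AB(5))
    also have "\<dots> = t [^] m \<otimes> (B' \<otimes> A)"
      using carr by (simp add: m_ac)
    finally have eq: "t [^] n \<otimes> (A' \<otimes> B) \<otimes> f = t [^] m \<otimes> (B' \<otimes> A)" .
    have mem: "A' \<otimes> B \<in> Z" "B' \<otimes> A \<in> Z" "ev (A' \<otimes> B) \<noteq> 0" "ev (B' \<otimes> A) \<noteq> 0"
      by (simp_all add: ring_data(3) subringE(6)[OF ring_data(1)] AB(1-4) AB'(1-4))
    show ?thesis
      by (rule exI[of _ n], rule exI[of _ m], rule exI[of _ "B' \<otimes> A"], rule exI[of _ "A' \<otimes> B"])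
        (intro conjI mem eq)
  qed
  note expansion = this
  show ?thesis
  proof (rule local_parameter.intro[OF field_axioms], rule local_parameter_axioms.intro)
    show "t \<in> Z" "t \<noteq> \<zero>" "ev t = 0"
      using t affine_fn_nonzero[of a b] by (simp_all add: affine_fn_in_Z ev_affine_fn)
    show "\<exists>n m A B. A \<in> Z \<and> B \<in> Z \<and> ev A \<noteq> 0 \<and> ev B \<noteq> 0 \<and>
        t [^] (n::nat) \<otimes> B \<otimes> f = t [^] (m::nat) \<otimes> A" if "f \<in> carrier R - {\<zero>}" for f
      by (rule expansion[OF that])
  qed (simp_all add: ring_data affine_fn_zero)
qed

text \<open>
  If \<open>F(0) \<noteq> 0\<close>, the fibre \<open>X = 0\<close> contains a second point, at which \<open>Y = - F(0)\<close>. After taking out a power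
  of \<open>X\<close>, a function \<open>p + q Y\<close> that still vanishes at the origin does not vanish at the second point.
  So its conjugate \<open>p - q F - q Y\<close> is a unit at the origin, while their product, the norm, is a
  polynomial in \<open>X\<close>.
\<close>
lemma unramified_local_parameter:
  assumes F0: "poly F 0 \<noteq> 0"
  shows "local_parameter R Z ev cst X"
proof (rule local_parameterI[OF refl])
  fix p q :: "'c poly" assume pq: "p \<noteq> 0 \<or> q \<noteq> 0"
  obtain a p0 q0 where a: "p = [:0, 1:] ^ a * p0" "q = [:0, 1:] ^ a * q0"
      "poly p0 0 \<noteq> 0 \<or> poly q0 0 \<noteq> 0"
    using split_common_power_of_x[OF pq] by blast
  have fac: "affine_fn p q = X [^] a \<otimes> affine_fn p0 q0"
    by (simp add: X_pow affine_fn_mult a)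
  show "splits X (affine_fn p q)"
  proof (cases "poly p0 0 = 0")
    case False
    then show ?thesis
      using fac by (intro splitsI[of "affine_fn p0 q0" "affine_fn 1 0" _ _ a]) (simp_all add: affine_fn_in_Z ev_affine_fn X_pow affine_fn_mult)
  next
    case True
    define C where "C = affine_fn (p0 - q0 * F) (- q0)"
    define N where "N = p0 * p0 - p0 * q0 * F + q0 * q0 * H"
    have evC: "ev C \<noteq> 0" using a(3) True F0 by (simp add: C_def ev_affine_fn)
    have CN: "C \<otimes> affine_fn p0 q0 = affine_fn N 0"
      by (simp add: C_def N_def affine_fn_mult affine_fn_eq_iff algebra_simps)
    have "C \<in> carrier R - {\<zero>}" "affine_fn p0 q0 \<in> carrier R - {\<zero>}"
      unfolding C_def by (rule affine_fn_nonzero; use a(3) True in auto)+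
    then have "N \<noteq> 0"
      using nonzero_mult_closed[of C "affine_fn p0 q0"] CN affine_fn_zero by auto
    then obtain b N0 where b: "N = [:0, 1:] ^ b * N0" "poly N0 0 \<noteq> 0"
      using split_common_power_of_x[of N 0] by auto
    have "C \<otimes> affine_fn p q = X [^] a \<otimes> (C \<otimes> affine_fn p0 q0)"
      unfolding fac by (simp add: C_def affine_fn_closed m_ac)
    also have "\<dots> = X [^] (a + b) \<otimes> affine_fn N0 0"
      unfolding CN by (simp add: X_pow affine_fn_mult b power_add mult.assoc)
    finally show ?thesis
      using evC b(2) by (intro splitsI[of "affine_fn N0 0" C _ _ "a + b"]) (simp_all add: C_def affine_fn_in_Z ev_affine_fn)
  qed
qed simp_all

context
  fixes H1 F1 :: "'c poly"
  assumes H1: "H = [:0, 1:] * H1" and F1: "F = [:0, 1:] * F1"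
begin

abbreviation ramification_unit :: 'a where
  "ramification_unit \<equiv> affine_fn (- H1) (- F1)"

lemma X_ramification: "X \<otimes> ramification_unit = Y \<otimes> Y"
  by (simp only: affine_fn_mult affine_fn_eq_iff) (simp add: H1 F1)

lemma ev_ramification_unit: "ev ramification_unit \<noteq> 0"
  using smooth by (simp add: ev_affine_fn H1 F1 poly_0_coeff_0)

text \<open>
  If \<open>F = X F\<^sub>1\<close> and \<open>H = X H\<^sub>1\<close>, the equation reads \<open>X (- H\<^sub>1 - F\<^sub>1 Y) = Y\<^sup>2\<close>, and the factor in parentheses
  is a unit at the origin because \<open>H\<^sub>1(0) \<noteq> 0\<close>. So \<open>X\<close> is \<open>Y\<^sup>2\<close> up to a unit, and in \<open>p + q Y\<close>, with \<open>p\<close>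
  and \<open>q\<close> not both vanishing at 0, the two summands have different orders.
\<close>
lemma ramified_local_parameter: "local_parameter R Z ev cst Y"
proof (rule local_parameterI[OF refl])
  fix p q :: "'c poly" assume pq: "p \<noteq> 0 \<or> q \<noteq> 0"
  let ?U = ramification_unit
  obtain a p0 q0 where a: "p = [:0, 1:] ^ a * p0" "q = [:0, 1:] ^ a * q0"
      "poly p0 0 \<noteq> 0 \<or> poly q0 0 \<noteq> 0"
    using split_common_power_of_x[OF pq] by blast
  have fac: "affine_fn p q = X [^] a \<otimes> affine_fn p0 q0"
    by (simp add: X_pow affine_fn_mult a)
  have carr: "?U \<in> carrier R"
    by (rule affine_fn_closed)
  have Ua: "?U [^] n \<in> Z" "ev (?U [^] n) \<noteq> 0" for n :: nat
    using ev_ramification_unit by (simp_all add: affine_fn_pow_mem ev_affine_fn_pow ev_affine_fn)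
  have "?U [^] a \<otimes> X [^] a = (Y \<otimes> Y) [^] a"
    using nat_pow_distrib[of ?U X a] m_comm[of ?U X] affine_fn_closed X_ramification by simp
  also have "\<dots> = Y [^] (2 * a)"
    using affine_fn_closed by (simp add: nat_pow_distrib nat_pow_mult mult_2)
  finally have UX: "?U [^] a \<otimes> X [^] a = Y [^] (2 * a)" .
  have U1: "?U [^] a \<otimes> affine_fn p q = Y [^] (2 * a) \<otimes> affine_fn p0 q0"
    unfolding fac using carr affine_fn_closed by (simp add: UX flip: m_assoc)
  show "splits Y (affine_fn p q)"
  proof (cases "poly p0 0 = 0")
    case False
    then show ?thesis
      using U1 Ua[of a]
      by (intro splitsI[of "affine_fn p0 q0" "?U [^] a" _ _ "2 * a"])
        (simp_all add: affine_fn_in_Z ev_affine_fn)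
  next
    case True
    obtain p1 where p1: "p0 = [:0, 1:] * p1"
      using True by (auto simp: poly_eq_0_iff_dvd elim: dvdE)
    define W where "W = affine_fn (- H1 * q0) (p1 - F1 * q0)"
    have UW: "?U \<otimes> affine_fn p0 q0 = Y \<otimes> W"
      by (simp add: W_def affine_fn_mult affine_fn_eq_iff p1 H1 F1 algebra_simps)
    have Wc: "W \<in> carrier R" by (simp add: W_def affine_fn_closed)
    have "?U [^] Suc a \<otimes> affine_fn p q = ?U \<otimes> (?U [^] a \<otimes> affine_fn p q)"
      using carr affine_fn_closed by (simp add: m_ac)
    also have "\<dots> = Y [^] (2 * a) \<otimes> (?U \<otimes> affine_fn p0 q0)"
      unfolding U1 using carr affine_fn_closed by (simp add: m_ac)
    also have "\<dots> = Y [^] Suc (2 * a) \<otimes> W"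
      unfolding UW using Wc affine_fn_closed by (simp add: m_assoc)
    finally show ?thesis
      using Ua[of "Suc a"] a(3) True ev_ramification_unit
      by (intro splitsI[of W "?U [^] Suc a" _ _ "Suc (2 * a)"]) (simp_all add: W_def affine_fn_in_Z ev_affine_fn)
  qed
qed simp_all

end

lemma affine_fn_local_ring:
  assumes P: "P \<in> closed_points R (range cst)" and X: "X \<in> local_ring R P"
  shows "affine_fn p 0 \<in> local_ring R P"
proof (induction p)
  case 0
  show ?case using affine_fn_zero subringE(2)[OF local_ring_subring[OF P]] by simp
next
  case (pCons a p)
  have "cst a \<in> local_ring R P"
    using closed_point_const[OF P, of "cst a"] affine_fn_closed[of "[:a:]" 0]
    by (cases "cst a = \<zero>") (auto simp: local_ring_def)
  moreover have "affine_fn (pCons a p) 0 = cst a \<oplus> X \<otimes> affine_fn p 0"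
    by (simp add: affine_fn_mult affine_fn_add)
  ultimately show ?case
    using pCons X subringE(6,7)[OF local_ring_subring[OF P]] by simp
qed

text \<open>
  A closed point whose maximal ideal contains \<open>X\<close> and \<open>Y\<close> contains every \<open>p(X) + q(X) Y\<close> with
  \<open>p(0) = 0\<close>, so the uniqueness of the point of a local parameter applies to it.
\<close>
theorem origin_closed_point:
  obtains P where "P \<in> rational_points R (range cst)"
    "X \<in> local_maximal_ideal R P" "Y \<in> local_maximal_ideal R P"
    "\<And>Q. Q \<in> closed_points R (range cst) \<Longrightarrow> X \<in> local_maximal_ideal R Q \<Longrightarrow>
       Y \<in> local_maximal_ideal R Q \<Longrightarrow> Q = P"
    "poly F 0 \<noteq> 0 \<Longrightarrow> P X = 1"
    "poly F 0 = 0 \<Longrightarrow> P Y = 1" "poly F 0 = 0 \<Longrightarrow> P X = 2"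
proof -
  have vanish: "A \<in> local_maximal_ideal R Q"
    if Q: "Q \<in> closed_points R (range cst)" "X \<in> local_maximal_ideal R Q" "Y \<in> local_maximal_ideal R Q"
      and A: "A \<in> Z" "ev A = 0" for Q A
  proof -
    obtain p q where pq: "A = affine_fn p q" "poly p 0 = 0"
      using A by (auto simp: Z_def ev_affine_fn)
    obtain p1 where p1: "p = [:0, 1:] * p1"
      using pq(2) by (auto simp: poly_eq_0_iff_dvd elim: dvdE)
    have "A = affine_fn p1 0 \<otimes> X \<oplus> affine_fn q 0 \<otimes> Y"
      by (simp add: pq p1 affine_fn_mult affine_fn_add mult.commute)
    then show ?thesis
      using local_maximal_ideal_add[OF Q(1)] local_maximal_ideal_mult[OF Q(1)]
        affine_fn_local_ring[OF Q(1)] Q(2,3) local_maximal_ideal_subset[OF Q(1)] by blast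
  qed
  show thesis
  proof (cases "poly F 0 = 0")
    case False
    interpret L: local_parameter R Z ev cst X
      by (rule unramified_local_parameter[OF False])
    show thesis
    proof (rule that[OF L.param_point_rational])
      show "X \<in> local_maximal_ideal R L.param_point" "Y \<in> local_maximal_ideal R L.param_point"
        by (simp_all add: L.param_point_vanishing affine_fn_in_Z ev_affine_fn)
      show "Q = L.param_point" if "Q \<in> closed_points R (range cst)"
        "X \<in> local_maximal_ideal R Q" "Y \<in> local_maximal_ideal R Q" for Q
        using L.param_point_unique[OF that(1)] vanish[OF that] by blast
    qed (use False L.param_point_t in simp_all)
  next
    case True
    obtain F1 where F1: "F = [:0, 1:] * F1"
      using True by (auto simp: poly_eq_0_iff_dvd elim: dvdE)
    obtain H1 where H1: "H = [:0, 1:] * H1"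
      using H_0 by (auto simp: poly_eq_0_iff_dvd elim: dvdE)
    interpret L: local_parameter R Z ev cst Y
      by (rule ramified_local_parameter[OF H1 F1])
    note P = L.param_point_closed_point
    let ?U = "affine_fn (- H1) (- F1)"
    have U: "?U \<in> carrier R - {\<zero>}" "L.vanishing_order ?U = 0"
      using L.ev_nonzero L.vanishing_order_unit affine_fn_in_Z ev_ramification_unit[OF H1 F1] by blast+
    have XY: "X \<in> carrier R - {\<zero>}" "Y \<in> carrier R - {\<zero>}"
      by (rule affine_fn_nonzero; simp)+
    have "L.param_point X + L.param_point ?U = L.param_point Y + L.param_point Y"
      using closed_point_mult[OF P XY(1) U(1)] closed_point_mult[OF P XY(2) XY(2)]
        X_ramification[OF H1 F1] by simp
    then have two: "L.param_point X = 2"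
      using U L.param_point_eq L.param_point_t by simp
    show thesis
    proof (rule that[OF L.param_point_rational])
      show "X \<in> local_maximal_ideal R L.param_point" "Y \<in> local_maximal_ideal R L.param_point"
        by (simp_all add: L.param_point_vanishing affine_fn_in_Z ev_affine_fn)
      show "Q = L.param_point" if "Q \<in> closed_points R (range cst)"
        "X \<in> local_maximal_ideal R Q" "Y \<in> local_maximal_ideal R Q" for Q
        using L.param_point_unique[OF that(1)] vanish[OF that] by blast
    qed (use True two L.param_point_t in simp_all)
  qed
qed

end

section \<open>Coordinates on the function field\<close>

lemma hyp_field_simps [simp]:
  "carrier (hyp_function_field f h) = UNIV"
  "\<zero>\<^bsub>hyp_function_field f h\<^esub> = (0, 0)"
  "\<one>\<^bsub>hyp_function_field f h\<^esub> = (1, 0)"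
  "(u, v) \<otimes>\<^bsub>hyp_function_field f h\<^esub> (u', v')
     = (u * u' - v * v' * to_fract h, u * v' + v * u' - v * v' * to_fract f)"
  "(u, v) \<oplus>\<^bsub>hyp_function_field f h\<^esub> (u', v') = (u + u', v + v')"
  by (simp_all add: hyp_function_field_def)

lemma hyp_function_field_cring: "cring (hyp_function_field f h)"
proof (rule cringI)
  let ?K = "hyp_function_field f h"
  show "abelian_group ?K"
  proof (rule abelian_groupI)
    fix a assume "a \<in> carrier ?K"
    obtain u v where "a = (u, v)" by (cases a)
    then show "\<exists>b\<in>carrier ?K. b \<oplus>\<^bsub>?K\<^esub> a = \<zero>\<^bsub>?K\<^esub>"
      by (intro bexI[of _ "(- u, - v)"]) simp_all
  qed (auto simp: split_paired_all)
  show "comm_monoid ?K"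
    by (rule comm_monoidI) (auto simp: split_paired_all algebra_simps)
qed (auto simp: split_paired_all algebra_simps)

text \<open>
  A nonzero \<open>u + v y\<close> is inverted by means of its norm \<open>N = u\<^sup>2 - u v f + v\<^sup>2 h\<close>. If \<open>N\<close> were zero, then
  \<open>(2 u - v f)\<^sup>2 = v\<^sup>2 (f\<^sup>2 - 4 h)\<close> would exhibit the discriminant as a square.
\<close>
lemma hyp_function_field_field:
  assumes "\<And>w. w * w \<noteq> to_fract (f ^ 2 - 4 * h)"
  shows "field (hyp_function_field f h)"
proof (rule cring.cring_fieldI2[OF hyp_function_field_cring])
  let ?K = "hyp_function_field f h"
  fix a assume "a \<in> carrier ?K" and nz: "a \<noteq> \<zero>\<^bsub>?K\<^esub>"
  obtain u v where a: "a = (u, v)" by (cases a)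
  define N where "N = u * u - u * v * to_fract f + v * v * to_fract h"
  have "N \<noteq> 0"
  proof
    assume N: "N = 0"
    show False
    proof (cases "v = 0")
      case True
      then show False using N nz a by (simp add: N_def)
    next
      case False
      have "(2 * u - v * to_fract f) * (2 * u - v * to_fract f)
          = 4 * N + v * v * (to_fract f ^ 2 - 4 * to_fract h)"
        by (simp add: N_def algebra_simps power2_eq_square)
      moreover have "to_fract (f ^ 2 - 4 * h) = to_fract f ^ 2 - 4 * to_fract h"
      proof -
        have "to_fract (f ^ 2 - 4 * h)
            = to_fract f * to_fract f - (to_fract h + to_fract h + to_fract h + to_fract h)"
          by (simp add: power2_eq_square flip: to_fract_mult to_fract_add to_fract_diff)
        then show ?thesis by (simp add: power2_eq_square)
      qed
      ultimately have "((2 * u - v * to_fract f) / v) * ((2 * u - v * to_fract f) / v)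
          = to_fract (f ^ 2 - 4 * h)"
        using N False by simp
      then show False using assms by blast
    qed
  qed
  have "u * ((u - v * to_fract f) / N) - v * (- v / N) * to_fract h
      = (u * u - u * v * to_fract f + v * v * to_fract h) / N"
    by (simp add: diff_divide_distrib add_divide_distrib algebra_simps)
  moreover have "u * (- v / N) + v * ((u - v * to_fract f) / N) - v * (- v / N) * to_fract f = 0"
    by (simp add: diff_divide_distrib algebra_simps)
  ultimately have "a \<otimes>\<^bsub>?K\<^esub> ((u - v * to_fract f) / N, - v / N) = \<one>\<^bsub>?K\<^esub>"
    using \<open>N \<noteq> 0\<close> by (simp add: a flip: N_def)
  then show "\<exists>b\<in>carrier ?K. a \<otimes>\<^bsub>?K\<^esub> b = \<one>\<^bsub>?K\<^esub>"
    by (intro bexI[of _ "((u - v * to_fract f) / N, - v / N)"]) simp_all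
qed simp

lemma odd_degree_not_square:
  fixes D :: "rat poly"
  assumes "odd (degree D)"
  shows "w * w \<noteq> to_fract D"
proof
  assume w: "w * w = to_fract D"
  obtain p q where q: "q \<noteq> 0" and wpq: "w = to_fract p / to_fract q"
    by (cases w) (auto simp: Fract_conv_to_fract)
  have "to_fract (p * p) = to_fract (q * q * D)"
    using w q by (simp add: wpq field_simps)
  then have eq: "p * p = q * q * D" by (simp only: to_fract_eq_iff)
  have D: "D \<noteq> 0" using assms by auto
  then have p: "p \<noteq> 0" using eq q by auto
  have "degree p + degree p = degree q + degree q + degree D"
    using arg_cong[OF eq, of degree] p q D by (simp add: degree_mult_eq)
  then show False using assms by presburger
qed

definition eval_at :: "rat poly fract \<Rightarrow> rat poly \<Rightarrow> rat poly fract" where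
  "eval_at X p = poly (map_poly (\<lambda>c. to_fract [:c:]) p) X"

lemma eval_at_0 [simp]: "eval_at X 0 = 0"
  by (simp add: eval_at_def)

lemma eval_at_pCons [simp]: "eval_at X (pCons c p) = to_fract [:c:] + X * eval_at X p"
  by (simp add: eval_at_def Polynomial.map_poly_pCons)

lemma const_hom: "map_poly_comm_ring_hom (\<lambda>c::rat. to_fract [:c:])"
  by unfold_locales (simp_all flip: to_fract_add to_fract_mult one_pCons)

lemma eval_at_add: "eval_at X (p + q) = eval_at X p + eval_at X q"
  and eval_at_mult: "eval_at X (p * q) = eval_at X p * eval_at X q"
  and eval_at_1 [simp]: "eval_at X 1 = 1"
proof -
  interpret map_poly_comm_ring_hom "\<lambda>c::rat. to_fract [:c:]" by (rule const_hom)
  show "eval_at X (p + q) = eval_at X p + eval_at X q"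
    "eval_at X (p * q) = eval_at X p * eval_at X q" "eval_at X 1 = 1"
    by (simp_all add: eval_at_def hom_distribs)
qed

lemma eval_at_minus: "eval_at X (- p) = - eval_at X p"
  using eval_at_add[of X p "- p"] by (simp add: eq_neg_iff_add_eq_0 add.commute)

lemma eval_at_diff: "eval_at X (p - q) = eval_at X p - eval_at X q"
  using eval_at_add[of X p "- q"] by (simp add: eval_at_minus)

lemma eval_at_power: "eval_at X (p ^ n) = eval_at X p ^ n"
  by (induction n) (simp_all add: eval_at_mult)

lemma eval_at_to_fract: "eval_at (to_fract q) p = to_fract (pcompose p q)"
  by (induction p) (simp_all add: pcompose_pCons)

lemma eval_at_x: "eval_at (to_fract [:0, 1:]) p = to_fract p"
  by (simp add: eval_at_to_fract)

text \<open>
  Reversing the coefficients expresses a polynomial in \<open>x\<close> through one in \<open>1/x\<close>; this is how functions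
  are rewritten in the coordinate at infinity.
\<close>
lemma eval_at_inverse_x:
  "to_fract p = to_fract [:0, 1:] ^ degree p * eval_at (1 / to_fract [:0, 1:]) (reflect_poly p)"
proof -
  let ?c = "\<lambda>c::rat. to_fract [:c:]" and ?x = "to_fract [:0, 1:] :: rat poly fract"
  interpret map_poly_comm_ring_hom ?c by (rule const_hom)
  have map: "map_poly ?c (reflect_poly p) = reflect_poly (map_poly ?c p)"
    by (rule poly_eqI) (simp add: coeff_map_poly coeff_reflect_poly degree_map_poly)
  have "poly (reflect_poly (map_poly ?c p)) (1 / ?x) = (1 / ?x) ^ degree p * poly (map_poly ?c p) ?x"
    by (simp add: poly_reflect_poly_nz degree_map_poly)
  moreover have "poly (map_poly ?c p) ?x = to_fract p"
    using eval_at_x[of p] by (simp only: eval_at_def)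
  ultimately have "eval_at (1 / ?x) (reflect_poly p) = (1 / ?x) ^ degree p * to_fract p"
    by (simp only: eval_at_def map)
  then show ?thesis
    by (simp add: power_divide)
qed

text \<open>
  New coordinates \<open>X\<close> and \<open>Y = \<beta> + \<alpha> y\<close> with \<open>X\<close> a generator of the rational function field. Substituting
  \<open>y = (Y - \<beta>) / \<alpha>\<close> into \<open>y\<^sup>2 + f y + h = 0\<close> and clearing denominators gives the formulas for \<open>F\<close> and \<open>H\<close>.
\<close>
locale coordinate_change =
  fixes f h :: "rat poly" and X \<alpha> \<beta> :: "rat poly fract" and F H :: "rat poly"
  assumes K: "field (hyp_function_field f h)"
    and X_transcendental: "eval_at X p = 0 \<Longrightarrow> p = 0"
    and X_generates: "\<exists>d p. d \<noteq> 0 \<and> eval_at X d * u = eval_at X p"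
    and \<alpha>: "\<alpha> \<noteq> 0"
    and F: "eval_at X F = \<alpha> * to_fract f - 2 * \<beta>"
    and H: "eval_at X H = \<alpha> * \<alpha> * to_fract h - \<alpha> * \<beta> * to_fract f + \<beta> * \<beta>"
    and vanish: "poly H 0 = 0"
    and smooth: "poly F 0 \<noteq> 0 \<or> coeff H 1 \<noteq> 0"
begin

abbreviation (input) affine_fn :: "rat poly \<Rightarrow> rat poly \<Rightarrow> hyp_function" where
  "affine_fn p q \<equiv> (eval_at X p + \<beta> * eval_at X q, \<alpha> * eval_at X q)"

lemma affine_model: "affine_model (hyp_function_field f h) affine_fn F H"
proof (rule affine_model.intro[OF K], rule affine_model_axioms.intro)
  let ?K = "hyp_function_field f h"
  show "affine_fn p q \<oplus>\<^bsub>?K\<^esub> affine_fn p' q' = affine_fn (p + p') (q + q')" for p q p' q'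
    by (simp add: eval_at_add algebra_simps)
  show "affine_fn p q \<otimes>\<^bsub>?K\<^esub> affine_fn p' q' = affine_fn (p * p' - q * q' * H) (p * q' + q * p' - q * q' * F)" for p q p' q'
    by (simp add: eval_at_add eval_at_diff eval_at_mult F H algebra_simps)
  show "p = 0 \<and> q = 0" if "affine_fn p q = \<zero>\<^bsub>?K\<^esub>" for p q
    using that \<alpha> X_transcendental by auto
  show "\<exists>d p q. d \<noteq> 0 \<and> affine_fn d 0 \<otimes>\<^bsub>?K\<^esub> a = affine_fn p q" if "a \<in> carrier ?K" for a
  proof -
    obtain u v where a: "a = (u, v)" by (cases a)
    obtain d q where d: "d \<noteq> 0" "eval_at X d * (v / \<alpha>) = eval_at X q"
      using X_generates by blast
    obtain e p where e: "e \<noteq> 0" "eval_at X e * (u - \<beta> * (v / \<alpha>)) = eval_at X p"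
      using X_generates by blast
    have v: "v = \<alpha> * (v / \<alpha>)" using \<alpha> by simp
    have "eval_at X (d * e) * v = \<alpha> * (eval_at X e * (eval_at X d * (v / \<alpha>)))"
      using \<alpha> by (simp add: eval_at_mult)
    then have 1: "eval_at X (d * e) * v = \<alpha> * eval_at X (e * q)"
      by (simp only: d eval_at_mult)
    have "eval_at X (d * e) * u = eval_at X d * (eval_at X e * (u - \<beta> * (v / \<alpha>)))
        + \<beta> * (eval_at X e * (eval_at X d * (v / \<alpha>)))"
      by (simp add: eval_at_mult algebra_simps)
    then have 2: "eval_at X (d * e) * u = eval_at X (d * p) + \<beta> * eval_at X (e * q)"
      by (simp only: d e eval_at_mult)
    have "affine_fn (d * e) 0 \<otimes>\<^bsub>?K\<^esub> a = affine_fn (d * p) (e * q)"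
      using 1 2 by (simp add: a)
    moreover have "d * e \<noteq> 0" using d e by simp
    ultimately show ?thesis by blast
  qed
qed (use vanish smooth in simp_all)

sublocale affine_model "hyp_function_field f h" affine_fn F H
  by (rule affine_model)

lemma constants: "range cst = hyp_constants"
  by (auto simp: hyp_const_def)

lemmas coordinate_point = origin_closed_point[unfolded constants]

end

lemma hyp_constants_local_ring:
  assumes "P \<in> closed_points (hyp_function_field f h) hyp_constants"
  shows "hyp_const c \<in> local_ring (hyp_function_field f h) P"
  using assms by (cases "c = 0") (simp_all add: closed_points_def local_ring_def hyp_const_def)

lemma eval_at_local_ring:
  assumes K: "field (hyp_function_field f h)"
    and P: "P \<in> closed_points (hyp_function_field f h) hyp_constants"
    and X: "(X, 0) \<in> local_ring (hyp_function_field f h) P"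
  shows "(eval_at X p, 0) \<in> local_ring (hyp_function_field f h) P"
proof -
  interpret field "hyp_function_field f h" by (rule K)
  show ?thesis
  proof (induction p)
    case 0
    show ?case by (simp add: local_ring_def)
  next
    case (pCons c p)
    have eq: "(eval_at X (pCons c p), 0) = hyp_const c \<oplus>\<^bsub>hyp_function_field f h\<^esub>
        (X, 0) \<otimes>\<^bsub>hyp_function_field f h\<^esub> (eval_at X p, 0)"
      by (simp add: hyp_const_def)
    show ?case
      unfolding eq using local_ring_subring[OF P]
      by (intro subringE(6,7) hyp_constants_local_ring[OF P] X pCons)
  qed
qed

lemma eval_at_local_maximal_ideal:
  assumes K: "field (hyp_function_field f h)"
    and P: "P \<in> closed_points (hyp_function_field f h) hyp_constants"
    and X: "(X, 0) \<in> local_maximal_ideal (hyp_function_field f h) P"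
    and p: "poly p 0 = 0"
  shows "(eval_at X p, 0) \<in> local_maximal_ideal (hyp_function_field f h) P"
proof -
  interpret field "hyp_function_field f h" by (rule K)
  obtain p1 where p1: "p = [:0, 1:] * p1"
    using p by (auto simp: poly_eq_0_iff_dvd elim: dvdE)
  have eq: "(eval_at X p, 0) = (eval_at X p1, 0) \<otimes>\<^bsub>hyp_function_field f h\<^esub> (X, 0)"
    by (simp add: p1 eval_at_mult mult.commute)
  have "(X, 0) \<in> local_ring (hyp_function_field f h) P"
    using X local_maximal_ideal_subset[OF P] by blast
  then show ?thesis
    unfolding eq by (intro local_maximal_ideal_mult[OF P] eval_at_local_ring[OF K P] X)
qed

section \<open>The points of the curve\<close>

context field
begin

text \<open>
  If \<open>y\<close> had a pole, dividing the equation by \<open>y\<close> would express \<open>y\<close> through \<open>A\<close>, \<open>B\<close> and the regular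
  function \<open>1/y\<close>.
\<close>
lemma integral_local_ring:
  assumes P: "P \<in> closed_points R k" and y: "y \<in> carrier R"
    and A: "A \<in> local_ring R P" and B: "B \<in> local_ring R P"
    and eq: "y \<otimes> y \<oplus> A \<otimes> y \<oplus> B = \<zero>"
  shows "y \<in> local_ring R P"
proof (rule ccontr)
  assume ny: "y \<notin> local_ring R P"
  note O = subringE[OF local_ring_subring[OF P]]
  have nz: "y \<in> carrier R - {\<zero>}" and "P y < 0"
    using ny y by (auto simp: local_ring_def)
  then have i: "inv y \<in> local_ring R P"
    using closed_point_inv[OF P nz] nonzero_inv_closed[OF nz] by (auto simp: local_ring_def)
  have carr: "inv y \<in> carrier R" "A \<in> carrier R" "B \<in> carrier R"
    using i A B O(1) by auto
  have inv: "y \<otimes> inv y = \<one>"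
    using nz field_Units by auto
  have "y = (y \<otimes> y \<oplus> A \<otimes> y \<oplus> B) \<otimes> inv y \<ominus> (A \<oplus> B \<otimes> inv y)"
  proof -
    have "(y \<otimes> y \<oplus> A \<otimes> y \<oplus> B) \<otimes> inv y = y \<otimes> (y \<otimes> inv y) \<oplus> A \<otimes> (y \<otimes> inv y) \<oplus> B \<otimes> inv y"
      using y carr by algebra
    also have "\<dots> = y \<oplus> (A \<oplus> B \<otimes> inv y)"
      unfolding inv using y carr by (simp add: a_ac)
    finally show ?thesis
      using y carr by algebra
  qed
  then have "y = \<ominus> (A \<oplus> B \<otimes> inv y)"
    unfolding eq using carr by (simp add: a_minus_def)
  also have "\<dots> \<in> local_ring R P"
    by (intro O i A B)
  finally show False using ny by contradiction
qed

lemma integral_local_maximal_ideal: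
  assumes P: "P \<in> closed_points R k" and y: "y \<in> carrier R"
    and A: "A \<in> local_maximal_ideal R P" and B: "B \<in> local_maximal_ideal R P"
    and eq: "y \<otimes> y \<oplus> A \<otimes> y \<oplus> B = \<zero>"
  shows "y \<in> local_maximal_ideal R P"
proof -
  have AB: "A \<in> local_ring R P" "B \<in> local_ring R P"
    using A B local_maximal_ideal_subset[OF P] by auto
  have yO: "y \<in> local_ring R P"
    by (rule integral_local_ring[OF P y AB eq])
  have carr: "A \<in> carrier R" "B \<in> carrier R"
    using AB by (auto simp: local_ring_def)
  have "y \<otimes> y = (y \<otimes> y \<oplus> A \<otimes> y \<oplus> B) \<ominus> (y \<otimes> A \<oplus> B)"
    using y carr by algebra
  then have "y \<otimes> y = \<ominus> (y \<otimes> A \<oplus> B)"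
    unfolding eq using y carr by (simp add: a_minus_def)
  moreover have "\<ominus> (y \<otimes> A \<oplus> B) \<in> local_maximal_ideal R P"
    by (intro local_maximal_ideal_minus[OF P] local_maximal_ideal_add[OF P]
        local_maximal_ideal_mult[OF P] yO A B)
  ultimately have "y \<otimes> y \<in> local_maximal_ideal R P"
    by simp
  then show ?thesis
    using closed_point_mult[OF P, of y y] y
    by (cases "y = \<zero>") (auto simp: local_maximal_ideal_def integral_iff)
qed

lemma unit_at_closed_point:
  assumes P: "P \<in> closed_points R k" and A: "A \<in> carrier R"
    and c: "c \<in> k" "c \<in> carrier R - {\<zero>}" and diff: "A \<ominus> c \<in> local_maximal_ideal R P"
  shows "A \<in> carrier R - {\<zero>}" "P A = 0"
proof -
  have Pc: "P c = 0"
    using closed_point_const[OF P c(1)] c(2) by blast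
  then have cO: "c \<in> local_ring R P"
    using c by (auto simp: local_ring_def)
  have cc: "c \<in> carrier R" using c by blast
  have "A = (A \<ominus> c) \<oplus> c"
    using A cc by algebra
  also have "\<dots> \<in> local_ring R P"
    using diff local_maximal_ideal_subset[OF P] cO
    by (intro subringE(7)[OF local_ring_subring[OF P]]) auto
  finally have AO: "A \<in> local_ring R P" .
  have "A \<notin> local_maximal_ideal R P"
  proof
    assume "A \<in> local_maximal_ideal R P"
    then have "A \<oplus> \<ominus> (A \<ominus> c) \<in> local_maximal_ideal R P"
      by (intro local_maximal_ideal_add[OF P] local_maximal_ideal_minus[OF P] diff)
    moreover have "A \<oplus> \<ominus> (A \<ominus> c) = c"
      using A cc by algebra
    ultimately show False
      using Pc c by (auto simp: local_maximal_ideal_def)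
  qed
  then show "A \<in> carrier R - {\<zero>}" "P A = 0"
    using AO by (auto simp: local_ring_def local_maximal_ideal_def)
qed

end

lemma hyp_minus [simp]: "\<ominus>\<^bsub>hyp_function_field f h\<^esub> (u, v) = (- u, - v)"
proof -
  interpret cring "hyp_function_field f h" by (rule hyp_function_field_cring)
  show ?thesis by (rule minus_equality) simp_all
qed

lemma coord_x_minus_const:
  "coord_x \<ominus>\<^bsub>hyp_function_field f h\<^esub> hyp_const r = (to_fract [:- r, 1:], 0)"
  by (simp add: a_minus_def coord_x_def hyp_const_def flip: to_fract_uminus to_fract_add)

lemma coord_y_minus_const:
  "coord_y \<ominus>\<^bsub>hyp_function_field f h\<^esub> hyp_const s = (- to_fract [:s:], 1)"
  by (simp add: a_minus_def coord_y_def hyp_const_def)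

lemma to_fract_const_1 [simp]: "to_fract [:1:] = 1"
  by (simp flip: one_pCons)

lemma eval_at_coordinate: "eval_at X [:0, 1:] = X"
  by simp

lemma hyp_pow: "(u, 0) [^]\<^bsub>hyp_function_field f h\<^esub> (n::nat) = (u ^ n, 0)"
  by (induction n) (simp_all add: nat_pow_def mult.commute)

lemma rational_function_decomposition:
  obtains a b where "b \<noteq> 0" "(u::rat poly fract) = to_fract a / to_fract b"
  by (cases u) (auto simp: Fract_conv_to_fract)

lemma pcompose_shift: "pcompose (pcompose p [:r, 1:]) [:- r, 1:] = (p :: rat poly)"
  by (simp add: pcompose_pCons flip: pcompose_assoc)

text \<open>
  Translation of \<open>(r, s)\<close> to the origin. The new \<open>F\<close> has value \<open>f(r) + 2 s\<close> at 0 and the new \<open>H\<close> has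
  linear coefficient \<open>h'(r) + s f'(r)\<close>: these are the partial derivatives of \<open>y\<^sup>2 + f y + h\<close> at \<open>(r, s)\<close>.
\<close>
lemma finite_coordinates:
  assumes K: "field (hyp_function_field f h)"
    and on: "s ^ 2 + s * poly f r + poly h r = 0"
    and smooth: "poly f r + 2 * s \<noteq> 0 \<or> poly (pderiv h) r + s * poly (pderiv f) r \<noteq> 0"
  shows "coordinate_change f h (to_fract [:- r, 1:]) 1 (- to_fract [:s:])
    (pcompose (f + [:2 * s:]) [:r, 1:]) (pcompose (h + smult s f + [:s ^ 2:]) [:r, 1:])"
proof (rule coordinate_change.intro)
  show "field (hyp_function_field f h)" by (rule K)
  show "p = 0" if "eval_at (to_fract [:- r, 1:]) p = 0" for p
    using that by (simp add: eval_at_to_fract pcompose_eq_0_iff)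
  show "\<exists>d p. d \<noteq> 0 \<and> eval_at (to_fract [:- r, 1:]) d * u = eval_at (to_fract [:- r, 1:]) p" for u
  proof -
    obtain a b where ab: "b \<noteq> 0" "u = to_fract a / to_fract b"
      by (rule rational_function_decomposition)
    show ?thesis
      by (rule exI[of _ "pcompose b [:r, 1:]"], rule exI[of _ "pcompose a [:r, 1:]"])
        (simp add: eval_at_to_fract pcompose_shift ab pcompose_eq_0_iff)
  qed
  have two: "to_fract [:2 * s:] = 2 * to_fract [:s:]"
  proof -
    have "[:2 * s:] = [:s:] + [:s:]" by simp
    then show ?thesis by (simp only: to_fract_add mult_2)
  qed
  show "eval_at (to_fract [:- r, 1:]) (pcompose (f + [:2 * s:]) [:r, 1:])
      = 1 * to_fract f - 2 * - to_fract [:s:]"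
    by (simp add: eval_at_to_fract pcompose_shift two)
  have sm: "smult s f = [:s:] * f" and sq: "[:s ^ 2:] = [:s:] * [:s:]"
    by (simp_all add: power2_eq_square)
  show "eval_at (to_fract [:- r, 1:]) (pcompose (h + smult s f + [:s ^ 2:]) [:r, 1:])
      = 1 * 1 * to_fract h - 1 * - to_fract [:s:] * to_fract f + - to_fract [:s:] * - to_fract [:s:]"
    unfolding eval_at_to_fract pcompose_shift sm sq to_fract_add to_fract_mult by simp
  show "poly (pcompose (h + smult s f + [:s ^ 2:]) [:r, 1:]) 0 = 0"
    using on by (simp add: poly_pcompose algebra_simps)
  let ?H = "pcompose (h + smult s f + [:s ^ 2:]) [:r, 1:]"
  have "coeff ?H 1 = poly (pderiv ?H) 0"
    by (simp add: poly_0_coeff_0 coeff_pderiv)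
  also have "\<dots> = poly (pderiv h) r + s * poly (pderiv f) r"
    by (simp add: pderiv_pcompose pderiv_add pderiv_smult pderiv_pCons poly_pcompose)
  finally show "poly (pcompose (f + [:2 * s:]) [:r, 1:]) 0 \<noteq> 0 \<or> coeff ?H 1 \<noteq> 0"
    using smooth by (simp add: poly_pcompose)
qed simp

lemma finite_point:
  assumes K: "field (hyp_function_field f h)"
    and on: "s ^ 2 + s * poly f r + poly h r = 0"
    and smooth: "poly f r + 2 * s \<noteq> 0 \<or> poly (pderiv h) r + s * poly (pderiv f) r \<noteq> 0"
  obtains P where "points_over f h r s = {P}"
    "P \<in> rational_points (hyp_function_field f h) hyp_constants"
    "poly f r + 2 * s \<noteq> 0 \<Longrightarrow> P (to_fract [:- r, 1:], 0) = 1"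
    "poly f r + 2 * s = 0 \<Longrightarrow> P (to_fract [:- r, 1:], 0) = 2"
proof -
  let ?K = "hyp_function_field f h"
  interpret coordinate_change f h "to_fract [:- r, 1:]" 1 "- to_fract [:s:]"
    "pcompose (f + [:2 * s:]) [:r, 1:]" "pcompose (h + smult s f + [:s ^ 2:]) [:r, 1:]"
    by (rule finite_coordinates[OF assms])
  have XY: "affine_fn [:0, 1:] 0 = coord_x \<ominus>\<^bsub>?K\<^esub> hyp_const r" "affine_fn 0 1 = coord_y \<ominus>\<^bsub>?K\<^esub> hyp_const s"
    by (simp_all add: coord_x_minus_const coord_y_minus_const)
  have F0: "poly (pcompose (f + [:2 * s:]) [:r, 1:]) 0 = poly f r + 2 * s"
    by (simp add: poly_pcompose)
  show thesis
  proof (rule coordinate_point[unfolded XY F0])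
    fix P
    assume P: "P \<in> rational_points ?K hyp_constants"
      "coord_x \<ominus>\<^bsub>?K\<^esub> hyp_const r \<in> local_maximal_ideal ?K P"
      "coord_y \<ominus>\<^bsub>?K\<^esub> hyp_const s \<in> local_maximal_ideal ?K P"
      and uniq: "\<And>Q. Q \<in> closed_points ?K hyp_constants \<Longrightarrow>
        coord_x \<ominus>\<^bsub>?K\<^esub> hyp_const r \<in> local_maximal_ideal ?K Q \<Longrightarrow>
        coord_y \<ominus>\<^bsub>?K\<^esub> hyp_const s \<in> local_maximal_ideal ?K Q \<Longrightarrow> Q = P"
      and X: "poly f r + 2 * s \<noteq> 0 \<Longrightarrow> P (coord_x \<ominus>\<^bsub>?K\<^esub> hyp_const r) = 1"
        "poly f r + 2 * s = 0 \<Longrightarrow> P (coord_x \<ominus>\<^bsub>?K\<^esub> hyp_const r) = 2"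
    have "P \<in> closed_points ?K hyp_constants"
      using P(1) by (simp add: rational_points_def)
    then have "points_over f h r s = {P}"
      unfolding points_over_def Let_def using P uniq by blast
    then show thesis
      by (rule that[OF _ P(1)]) (use X in \<open>simp_all add: coord_x_minus_const\<close>)
  qed
qed

locale odd_hyperelliptic =
  fixes g :: nat and f :: "rat poly"
  assumes deg: "degree f \<le> g"
begin

abbreviation h :: "rat poly" where "h \<equiv> monom 1 (2 * g + 1)"
abbreviation K :: "hyp_function ring" where "K \<equiv> hyp_function_field f h"

text \<open>
  The bound on the degree of \<open>f\<close> makes \<open>h\<close> dominate. The odd degree has two uses: the discriminant is
  not a square, and there is only one point at infinity.
\<close>
lemma degree_discriminant: "degree (f ^ 2 - 4 * h) = 2 * g + 1"
proof -
  have h4: "4 * h = monom 4 (2 * g + 1)"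
    by (simp add: numeral_poly smult_monom)
  have "degree (f ^ 2) < 2 * g + 1"
    using deg degree_power_le[of f 2] by simp
  then have "degree (- monom 4 (2 * g + 1) + f ^ 2) = 2 * g + 1"
    by (subst degree_add_eq_left) (simp_all add: degree_monom_eq)
  then show ?thesis
    unfolding h4 by simp
qed

lemma K_field: "field K"
  by (rule hyp_function_field_field, rule odd_degree_not_square, unfold degree_discriminant) simp

sublocale K: field K
  by (rule K_field)

abbreviation x_inv :: "rat poly fract" where "x_inv \<equiv> 1 / to_fract [:0, 1:]"

lemma to_fract_h: "to_fract h = to_fract [:0, 1:] ^ (2 * g + 1)"
  using eval_at_x[of "[:0, 1:] ^ (2 * g + 1)"]
  by (simp only: eval_at_power eval_at_coordinate monom_altdef smult_1_left)

text \<open>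
  In \<open>X = 1/x\<close> and \<open>Y = y / x\<^bsup>g+1\<^esup>\<close> the equation becomes \<open>Y\<^sup>2 + F(X) Y + X = 0\<close>, where
  \<open>F(X) = X\<^bsup>g+1\<^esup> f(1/X)\<close> is a polynomial divisible by \<open>X\<close> because \<open>f\<close> has degree at most \<open>g\<close>.
\<close>
lemma infinity_coordinates:
  "coordinate_change f h x_inv (x_inv ^ (g + 1)) 0
    ([:0, 1:] ^ (g + 1 - degree f) * reflect_poly f) [:0, 1:]"
proof (rule coordinate_change.intro)
  have x: "to_fract [:0, 1:] \<noteq> (0 :: rat poly fract)" by simp
  show "field (hyp_function_field f h)" by (rule K_field)
  have reflect: "eval_at x_inv (reflect_poly p) = x_inv ^ degree p * to_fract p" for p
    by (subst (2) eval_at_inverse_x) (simp add: power_divide)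
  show "p = 0" if p: "eval_at x_inv p = 0" for p
  proof (rule ccontr)
    assume "p \<noteq> 0"
    then obtain a q where q: "p = [:0, 1:] ^ a * q" "poly q 0 \<noteq> 0"
      using split_common_power_of_x[of p 0] by auto
    then have "eval_at x_inv q = 0"
      using p by (simp add: eval_at_mult eval_at_power)
    moreover have "reflect_poly (reflect_poly q) = q"
      using q(2) by (simp add: poly_0_coeff_0)
    ultimately have "reflect_poly q = 0"
      using reflect[of "reflect_poly q"] by simp
    then show False using q(2) by simp
  qed
  show "\<exists>d p. d \<noteq> 0 \<and> eval_at x_inv d * u = eval_at x_inv p" for u
  proof -
    obtain a b where ab: "b \<noteq> 0" "u = to_fract a / to_fract b"
      by (rule rational_function_decomposition)
    have "eval_at x_inv ([:0, 1:] ^ degree a * reflect_poly b) * u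
        = eval_at x_inv ([:0, 1:] ^ degree b * reflect_poly a)"
      using ab by (simp add: eval_at_mult eval_at_power reflect mult_ac)
    moreover have "[:0, 1:] ^ degree a * reflect_poly b \<noteq> 0"
      using ab by simp
    ultimately show ?thesis by blast
  qed
  show "x_inv ^ (g + 1) \<noteq> 0"
    by simp
  have "x_inv ^ (g + 1) = x_inv ^ (g + 1 - degree f) * x_inv ^ degree f"
    using deg by (simp flip: power_add)
  then show "eval_at x_inv ([:0, 1:] ^ (g + 1 - degree f) * reflect_poly f)
      = x_inv ^ (g + 1) * to_fract f - 2 * 0"
    by (simp add: eval_at_mult eval_at_power reflect)
  show "eval_at x_inv [:0, 1:] = x_inv ^ (g + 1) * x_inv ^ (g + 1) * to_fract h
      - x_inv ^ (g + 1) * 0 * to_fract f + 0 * 0"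
    unfolding to_fract_h by (simp add: field_simps power_add mult_2_right)
qed simp_all

text \<open>
  The orders follow from those of \<open>X = 1/x\<close> and \<open>Y = y / x\<^bsup>g+1\<^esup>\<close>, which are 2 and 1. Conversely, at a point
  where \<open>x\<close> and \<open>y\<close> are not both regular, \<open>x\<close> is not regular, since \<open>y\<close> is integral over the polynomials
  in \<open>x\<close>. So \<open>X\<close> vanishes there, and then so does \<open>Y\<close>, being a root of a monic polynomial whose other
  coefficients vanish.
\<close>
lemma infinity_point:
  obtains P where "points_at_infinity f h = {P}" "P \<in> rational_points K hyp_constants"
    "P (x_inv, 0) = 2" "P coord_y = - int (2 * g + 1)"
proof -
  interpret coordinate_change f h x_inv "x_inv ^ (g + 1)" 0
    "[:0, 1:] ^ (g + 1 - degree f) * reflect_poly f" "[:0, 1:]"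
    by (rule infinity_coordinates)
  let ?F = "[:0, 1:] ^ (g + 1 - degree f) * reflect_poly f"
  let ?w = "(0, x_inv ^ (g + 1)) :: hyp_function"
  have XY: "affine_fn [:0, 1:] 0 = (x_inv, 0)" "affine_fn 0 1 = ?w"
    by simp_all
  have F0: "poly ?F 0 = 0"
    using deg by simp
  have x_inv: "coord_x \<otimes>\<^bsub>K\<^esub> (x_inv, 0) = \<one>\<^bsub>K\<^esub>"
    by (simp add: coord_x_def)
  have xnz: "coord_x \<in> carrier K - {\<zero>\<^bsub>K\<^esub>}" and inz: "(x_inv, 0) \<in> carrier K - {\<zero>\<^bsub>K\<^esub>}"
    and ynz: "coord_y \<in> carrier K - {\<zero>\<^bsub>K\<^esub>}"
    by (simp_all add: coord_x_def coord_y_def)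
  show thesis
  proof (rule coordinate_point[unfolded XY])
    fix P
    assume P: "P \<in> rational_points K hyp_constants"
      and uniq: "\<And>Q. Q \<in> closed_points K hyp_constants \<Longrightarrow>
        (x_inv, 0) \<in> local_maximal_ideal K Q \<Longrightarrow> ?w \<in> local_maximal_ideal K Q \<Longrightarrow> Q = P"
      and F1: "poly ?F 0 = 0 \<Longrightarrow> P ?w = 1" and F2: "poly ?F 0 = 0 \<Longrightarrow> P (x_inv, 0) = 2"
    have Pc: "P \<in> closed_points K hyp_constants"
      using P by (simp add: rational_points_def)
    have Pi: "P (x_inv, 0) = 2" and Pw: "P ?w = 1"
      using F1[OF F0] F2[OF F0] by simp_all
    have Px: "P coord_x = - 2"
      using K.closed_point_mult[OF Pc xnz inz] K.closed_point_one[OF Pc] Pi x_inv by simp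
    then have "coord_x \<notin> local_ring K P"
      using xnz by (simp add: local_ring_def)
    then have mem: "P \<in> points_at_infinity f h"
      using Pc by (simp add: points_at_infinity_def Let_def)
    have "?w = coord_y \<otimes>\<^bsub>K\<^esub> ((x_inv, 0) [^]\<^bsub>K\<^esub> (g + 1))"
      by (simp only: coord_y_def hyp_pow hyp_field_simps) simp
    then have Py: "P coord_y = - int (2 * g + 1)"
      using K.closed_point_mult[OF Pc ynz K.nonzero_pow_closed[OF inz], of "g + 1"]
        K.closed_point_pow[OF Pc inz, of "g + 1"] Pi Pw by simp
    have "Q = P" if Q: "Q \<in> points_at_infinity f h" for Q
    proof -
      have Qc: "Q \<in> closed_points K hyp_constants" and
        notreg: "\<not> (coord_x \<in> local_ring K Q \<and> coord_y \<in> local_ring K Q)"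
        using Q by (auto simp: points_at_infinity_def Let_def)
      have "coord_x \<notin> local_ring K Q"
      proof
        assume x: "coord_x \<in> local_ring K Q"
        then have poly: "(to_fract p, 0) \<in> local_ring K Q" for p
          using eval_at_local_ring[OF K_field Qc, of "to_fract [:0, 1:]" p]
          by (simp only: eval_at_x coord_x_def)
        have "coord_y \<otimes>\<^bsub>K\<^esub> coord_y \<oplus>\<^bsub>K\<^esub> (to_fract f, 0) \<otimes>\<^bsub>K\<^esub> coord_y \<oplus>\<^bsub>K\<^esub> (to_fract h, 0) = \<zero>\<^bsub>K\<^esub>"
          by (simp add: coord_y_def)
        then have "coord_y \<in> local_ring K Q"
          by (intro K.integral_local_ring[OF Qc _ poly poly]) simp_all
        then show False using x notreg by simp
      qed
      then have "Q coord_x < 0"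
        using xnz by (auto simp: local_ring_def)
      then have "Q (x_inv, 0) > 0"
        using K.closed_point_mult[OF Qc xnz inz] K.closed_point_one[OF Qc] x_inv by simp
      then have i: "(x_inv, 0) \<in> local_maximal_ideal K Q"
        by (simp add: local_maximal_ideal_def)
      have eq: "?w \<otimes>\<^bsub>K\<^esub> ?w \<oplus>\<^bsub>K\<^esub> (eval_at x_inv ?F, 0) \<otimes>\<^bsub>K\<^esub> ?w
          \<oplus>\<^bsub>K\<^esub> (eval_at x_inv [:0, 1:], 0) = \<zero>\<^bsub>K\<^esub>"
        by (simp only: F H hyp_field_simps) simp
      have mem: "(eval_at x_inv ?F, 0) \<in> local_maximal_ideal K Q"
        "(eval_at x_inv [:0, 1:], 0) \<in> local_maximal_ideal K Q"
        by (rule eval_at_local_maximal_ideal[OF K_field Qc i F0])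
          (rule eval_at_local_maximal_ideal[OF K_field Qc i], simp)
      have "?w \<in> local_maximal_ideal K Q"
        by (rule K.integral_local_maximal_ideal[OF Qc _ mem eq]) simp
      then show "Q = P"
        using uniq[OF Qc i] by blast
    qed
    then have "points_at_infinity f h = {P}"
      using mem by blast
    then show thesis
      by (rule that[OF _ P Pi Py])
  qed
qed

end

section \<open>The divisors of \<open>y\<close> and of \<open>x - r\<close>\<close>

lemma points_over_regular:
  assumes P: "P \<in> points_over f h r s" and K: "field (hyp_function_field f h)"
  shows "P \<in> closed_points (hyp_function_field f h) hyp_constants" "P \<notin> points_at_infinity f h"
proof -
  let ?K = "hyp_function_field f h"
  interpret field ?K by (rule K)
  show Pc: "P \<in> closed_points ?K hyp_constants"
    using P by (simp add: points_over_def Let_def)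
  have regular: "a \<in> local_ring ?K P"
    if "a \<ominus>\<^bsub>?K\<^esub> hyp_const c \<in> local_maximal_ideal ?K P" for a c
  proof -
    have "a = (a \<ominus>\<^bsub>?K\<^esub> hyp_const c) \<oplus>\<^bsub>?K\<^esub> hyp_const c"
      by (cases a) (simp add: a_minus_def hyp_const_def)
    moreover have "(a \<ominus>\<^bsub>?K\<^esub> hyp_const c) \<oplus>\<^bsub>?K\<^esub> hyp_const c \<in> local_ring ?K P"
      using that local_maximal_ideal_subset[OF Pc]
      by (intro subringE(7)[OF local_ring_subring[OF Pc]] hyp_constants_local_ring[OF Pc]) blast
    ultimately show ?thesis by simp
  qed
  have "coord_x \<in> local_ring ?K P" "coord_y \<in> local_ring ?K P"
    using P by (auto simp: points_over_def Let_def intro: regular)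
  then show "P \<notin> points_at_infinity f h"
    by (simp add: points_at_infinity_def Let_def)
qed

lemma points_over_disjoint:
  assumes P: "P \<in> points_over f h r s" "P \<in> points_over f h r' s'"
    and K: "field (hyp_function_field f h)"
  shows "r = r'"
proof (rule ccontr)
  assume "r \<noteq> r'"
  let ?K = "hyp_function_field f h"
  interpret field ?K by (rule K)
  note Pc = points_over_regular(1)[OF P(1) K]
  let ?A = "(to_fract [:- r, 1:], 0) :: hyp_function"
  have mem: "?A \<in> local_maximal_ideal ?K P" "(to_fract [:- r', 1:], 0) \<in> local_maximal_ideal ?K P"
    using P by (simp_all add: points_over_def Let_def coord_x_minus_const)
  have "?A \<ominus>\<^bsub>?K\<^esub> hyp_const (r' - r) = (to_fract [:- r', 1:], 0)"
    by (simp add: a_minus_def hyp_const_def flip: to_fract_diff)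
  then have "P ?A = 0"
    using unit_at_closed_point(2)[OF Pc, of ?A "hyp_const (r' - r)"] mem(2) \<open>r \<noteq> r'\<close>
    by (simp add: hyp_const_def)
  then show False
    using mem(1) by (simp add: local_maximal_ideal_def)
qed

lemma points_over_origin_iff:
  "P \<in> points_over f h 0 0 \<longleftrightarrow> P \<in> closed_points (hyp_function_field f h) hyp_constants \<and>
     coord_x \<in> local_maximal_ideal (hyp_function_field f h) P \<and>
     coord_y \<in> local_maximal_ideal (hyp_function_field f h) P"
proof -
  have "coord_x \<ominus>\<^bsub>hyp_function_field f h\<^esub> hyp_const 0 = coord_x"
    "coord_y \<ominus>\<^bsub>hyp_function_field f h\<^esub> hyp_const 0 = coord_y"
    unfolding coord_x_minus_const coord_y_minus_const by (simp_all add: coord_x_def coord_y_def)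
  then show ?thesis
    by (simp add: points_over_def Let_def)
qed

context odd_hyperelliptic
begin

lemma regular_polynomials:
  assumes S: "S \<in> closed_points K hyp_constants" "S \<notin> points_at_infinity f h"
  shows "coord_x \<in> local_ring K S" "coord_y \<in> local_ring K S" "(to_fract p, 0) \<in> local_ring K S"
proof -
  show x: "coord_x \<in> local_ring K S" and "coord_y \<in> local_ring K S"
    using S by (auto simp: points_at_infinity_def Let_def)
  show "(to_fract p, 0) \<in> local_ring K S"
    using eval_at_local_ring[OF K_field S(1), of "to_fract [:0, 1:]" p] x
    by (simp only: eval_at_x coord_x_def)
qed

lemma vanishing_polynomials:
  assumes S: "S \<in> closed_points K hyp_constants"
    and x: "(to_fract [:- r, 1:], 0) \<in> local_maximal_ideal K S" and p: "poly p r = 0"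
  shows "(to_fract p, 0) \<in> local_maximal_ideal K S"
  using eval_at_local_maximal_ideal[OF K_field S x, of "pcompose p [:r, 1:]"] p
  by (simp add: poly_pcompose eval_at_to_fract pcompose_shift)

text \<open>
  The norm relation \<open>y (y + f) = - x\<^bsup>2g+1\<^esup>\<close> shows that a finite point at which \<open>y\<close> vanishes lies over
  \<open>x = 0\<close>, hence is \<open>O\<close>. At \<open>O\<close>, where \<open>y + f\<close> has the nonzero value \<open>f(0)\<close>, it gives the order of \<open>y\<close>.
\<close>
lemma divisor_of_y:
  assumes f0: "poly f 0 \<noteq> 0"
    and pI: "points_at_infinity f h = {pI}" "pI coord_y = - int (2 * g + 1)"
    and pO: "points_over f h 0 0 = {pO}" "pO coord_x = 1"
  shows "frag_cmul (int (2 * g + 1)) (frag_of pO - frag_of pI) \<in> principal_divisors K hyp_constants"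
proof (rule K.two_point_divisor_principal)
  have pOm: "pO \<in> points_over f h 0 0" using pO by simp
  note pOc = points_over_regular(1)[OF pOm K_field]
  have nz: "coord_x \<in> carrier K - {\<zero>\<^bsub>K\<^esub>}" "coord_y \<in> carrier K - {\<zero>\<^bsub>K\<^esub>}"
    by (simp_all add: coord_x_def coord_y_def)
  show "coord_y \<in> carrier K - {\<zero>\<^bsub>K\<^esub>}" by (rule nz)
  show "pI \<in> closed_points K hyp_constants"
    using pI(1) by (auto simp: points_at_infinity_def Let_def)
  show "pI coord_y = - int (2 * g + 1)" by (rule pI)
  show "pO \<in> closed_points K hyp_constants" by (rule pOc)
  show "pI \<noteq> pO"
    using points_over_regular(2)[OF pOm K_field] pI(1) by auto
  let ?y' = "(to_fract f, 1) :: hyp_function"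
  have prod: "coord_y \<otimes>\<^bsub>K\<^esub> ?y' = \<ominus>\<^bsub>K\<^esub> (coord_x [^]\<^bsub>K\<^esub> (2 * g + 1))"
    unfolding coord_y_def coord_x_def hyp_pow hyp_minus hyp_field_simps to_fract_h by simp
  have y'nz: "?y' \<in> carrier K - {\<zero>\<^bsub>K\<^esub>}"
    by simp
  have norm: "S coord_y + S ?y' = int (2 * g + 1) * S coord_x"
    if S: "S \<in> closed_points K hyp_constants" for S
    using K.closed_point_mult[OF S nz(2) y'nz]
      K.closed_point_minus[OF S K.nonzero_pow_closed[OF nz(1), of "2 * g + 1"]]
      K.closed_point_pow[OF S nz(1), of "2 * g + 1"]
    unfolding prod by simp
  have mem: "(to_fract [:- 0, 1:], 0) \<in> local_maximal_ideal K pO" "coord_y \<in> local_maximal_ideal K pO"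
    using pOm by (simp_all add: points_over_origin_iff coord_x_def)
  have "(to_fract (f - [:poly f 0:]), 0) \<oplus>\<^bsub>K\<^esub> coord_y \<in> local_maximal_ideal K pO"
    by (intro K.local_maximal_ideal_add[OF pOc] vanishing_polynomials[OF pOc mem(1)] mem(2)) simp
  moreover have "?y' \<ominus>\<^bsub>K\<^esub> hyp_const (poly f 0) = (to_fract (f - [:poly f 0:]), 0) \<oplus>\<^bsub>K\<^esub> coord_y"
    by (simp add: a_minus_def hyp_const_def coord_y_def)
  ultimately have "pO ?y' = 0"
    using f0 by (intro K.unit_at_closed_point(2)[OF pOc, of _ "hyp_const (poly f 0)"])
      (simp_all add: hyp_const_def)
  then show "pO coord_y = int (2 * g + 1)"
    using norm[OF pOc] pO(2) by simp
  show "S coord_y = 0"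
    if S: "S \<in> closed_points K hyp_constants" and ne: "S \<noteq> pI" "S \<noteq> pO" for S
  proof (rule ccontr)
    assume Sy: "S coord_y \<noteq> 0"
    have ninf: "S \<notin> points_at_infinity f h" using ne pI by simp
    note reg = regular_polynomials[OF S ninf]
    have pos: "S coord_y > 0"
      using reg(2) Sy nz by (simp add: local_ring_def)
    have "?y' = (to_fract f, 0) \<oplus>\<^bsub>K\<^esub> coord_y"
      by (simp add: coord_y_def)
    also have "\<dots> \<in> local_ring K S"
      by (intro subringE(7)[OF K.local_ring_subring[OF S]] reg)
    finally have "S ?y' \<ge> 0"
      by (simp add: local_ring_def)
    then have "int (2 * g + 1) * S coord_x > 0"
      using norm[OF S] pos by simp
    then have "S coord_x > 0"
      by (simp add: zero_less_mult_iff)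
    then have "S \<in> points_over f h 0 0"
      using S pos nz by (simp add: points_over_origin_iff local_maximal_ideal_def)
    then show False using ne pO by simp
  qed
qed

text \<open>
  At a finite point where \<open>x - r\<close> vanishes, \<open>y - s\<close> satisfies a monic quadratic equation whose other
  coefficients \<open>f + 2 s\<close> and \<open>h + s f + s\<^sup>2\<close> vanish, because \<open>s\<close> is the double root of the equation over \<open>r\<close>.
  So \<open>y - s\<close> vanishes too, and the point is the one over \<open>(r, s)\<close>. At infinity \<open>(x - r) / x\<close> has value 1,
  so \<open>x - r\<close> and \<open>x\<close> have the same order.
\<close>
lemma divisor_of_x_minus_const:
  assumes pI: "points_at_infinity f h = {pI}" "pI (x_inv, 0) = 2"
    and P: "points_over f h r s = {P}" "P (to_fract [:- r, 1:], 0) = 2"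
    and tangent: "poly f r = - 2 * s" and on: "s ^ 2 = poly h r"
  shows "frag_cmul (int 2) (frag_of P - frag_of pI) \<in> principal_divisors K hyp_constants"
proof (rule K.two_point_divisor_principal)
  let ?A = "(to_fract [:- r, 1:], 0) :: hyp_function"
  have Pm: "P \<in> points_over f h r s" using P by simp
  note Pc = points_over_regular(1)[OF Pm K_field]
  show nz: "?A \<in> carrier K - {\<zero>\<^bsub>K\<^esub>}" by simp
  show Ic: "pI \<in> closed_points K hyp_constants"
    using pI(1) by (auto simp: points_at_infinity_def Let_def)
  show "P \<in> closed_points K hyp_constants" by (rule Pc)
  show "P ?A = int 2" using P by simp
  show "pI \<noteq> P"
    using points_over_regular(2)[OF Pm K_field] pI(1) by auto
  have inz: "(x_inv, 0) \<in> carrier K - {\<zero>\<^bsub>K\<^esub>}" by simp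
  then have i: "(x_inv, 0) \<in> local_maximal_ideal K pI"
    using pI(2) by (simp add: local_maximal_ideal_def)
  have minus_r: "to_fract [:- r:] = - to_fract [:r:]"
    by (simp flip: to_fract_uminus)
  have x: "to_fract [:- r, 1:] = to_fract [:0, 1:] - to_fract [:r:]"
    by (simp flip: to_fract_diff)
  have "(?A \<otimes>\<^bsub>K\<^esub> (x_inv, 0)) \<ominus>\<^bsub>K\<^esub> hyp_const 1 = hyp_const (- r) \<otimes>\<^bsub>K\<^esub> (x_inv, 0)"
    by (simp add: a_minus_def hyp_const_def x minus_r diff_divide_distrib)
  also have "\<dots> \<in> local_maximal_ideal K pI"
    by (intro K.local_maximal_ideal_mult[OF Ic] hyp_constants_local_ring[OF Ic] i)
  finally have "pI (?A \<otimes>\<^bsub>K\<^esub> (x_inv, 0)) = 0"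
    by (intro K.unit_at_closed_point(2)[OF Ic, of _ "hyp_const 1"]) (simp_all add: hyp_const_def)
  then show "pI ?A = - int 2"
    using K.closed_point_mult[OF Ic nz inz] pI(2) by simp
  show "S ?A = 0"
    if S: "S \<in> closed_points K hyp_constants" and ne: "S \<noteq> pI" "S \<noteq> P" for S
  proof (rule ccontr)
    assume SA: "S ?A \<noteq> 0"
    have ninf: "S \<notin> points_at_infinity f h" using ne pI by simp
    have "S ?A > 0"
      using regular_polynomials(3)[OF S ninf, of "[:- r, 1:]"] SA by (simp add: local_ring_def)
    then have A: "?A \<in> local_maximal_ideal K S"
      by (simp add: local_maximal_ideal_def)
    let ?Y = "(- to_fract [:s:], 1) :: hyp_function"
    let ?F = "f + [:s:] + [:s:]" and ?H = "h + [:s:] * f + [:s:] * [:s:]"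
    have eq: "?Y \<otimes>\<^bsub>K\<^esub> ?Y \<oplus>\<^bsub>K\<^esub> (to_fract ?F, 0) \<otimes>\<^bsub>K\<^esub> ?Y \<oplus>\<^bsub>K\<^esub> (to_fract ?H, 0) = \<zero>\<^bsub>K\<^esub>"
      unfolding to_fract_add to_fract_mult hyp_field_simps by (simp add: algebra_simps)
    have mem: "(to_fract ?F, 0) \<in> local_maximal_ideal K S" "(to_fract ?H, 0) \<in> local_maximal_ideal K S"
      using tangent on
      by (intro vanishing_polynomials[OF S A]; simp add: power2_eq_square)+
    have "?Y \<in> local_maximal_ideal K S"
      by (rule K.integral_local_maximal_ideal[OF S _ mem eq]) simp
    then have "S \<in> points_over f h r s"
      using S A by (simp add: points_over_def Let_def coord_x_minus_const coord_y_minus_const)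
    then show False using ne P by simp
  qed
qed

text \<open>
  The conditions on \<open>(r, s)\<close> say that it is a smooth point of the curve at which the tangent is vertical,
  so that \<open>x - r\<close> vanishes there to order 2; \<open>r \<noteq> 0\<close> separates it from the point over the origin.
\<close>
theorem tangent_points_define_tame_K2_elements:
  assumes f0: "poly f 0 \<noteq> 0"
  obtains pI pO where "points_at_infinity f h = {pI}" "points_over f h 0 0 = {pO}"
    "\<And>r s. r \<noteq> 0 \<Longrightarrow> s ^ 2 = poly h r \<Longrightarrow> poly f r = - 2 * s \<Longrightarrow>
       poly (pderiv h) r + s * poly (pderiv f) r \<noteq> 0 \<Longrightarrow>
       \<exists>P. points_over f h r s = {P} \<and> defines_tame_K2_element K hyp_constants pI pO P"
proof -
  obtain pI where pI: "points_at_infinity f h = {pI}" "pI \<in> rational_points K hyp_constants"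
      "pI (x_inv, 0) = 2" "pI coord_y = - int (2 * g + 1)"
    by (rule infinity_point)
  have h0: "poly h 0 = 0" by (simp add: poly_monom)
  obtain pO where pO: "points_over f h 0 0 = {pO}" "pO \<in> rational_points K hyp_constants"
      "pO coord_x = 1"
  proof (rule finite_point[OF K_field, of 0 0])
    show "0 ^ 2 + 0 * poly f 0 + poly h 0 = 0" using h0 by simp
    show "poly f 0 + 2 * 0 \<noteq> 0 \<or> poly (pderiv h) 0 + 0 * poly (pderiv f) 0 \<noteq> 0"
      using f0 by simp
    fix P assume "points_over f h 0 0 = {P}" "P \<in> rational_points K hyp_constants"
      "poly f 0 + 2 * 0 \<noteq> 0 \<Longrightarrow> P (to_fract [:- 0, 1:], 0) = 1"
    then show thesis
      using f0 by (intro that[of P]) (simp_all add: coord_x_def)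
  qed
  show thesis
  proof (rule that[OF pI(1) pO(1)])
    fix r s
    assume r: "r \<noteq> 0" and on: "s ^ 2 = poly h r" and tangent: "poly f r = - 2 * s"
      and simple: "poly (pderiv h) r + s * poly (pderiv f) r \<noteq> 0"
    obtain P where P: "points_over f h r s = {P}" "P \<in> rational_points K hyp_constants"
        "P (to_fract [:- r, 1:], 0) = 2"
    proof (rule finite_point[OF K_field, of s r])
      show "s ^ 2 + s * poly f r + poly h r = 0"
        using on tangent by (simp add: power2_eq_square)
      fix P assume "points_over f h r s = {P}" "P \<in> rational_points K hyp_constants"
        "poly f r + 2 * s = 0 \<Longrightarrow> P (to_fract [:- r, 1:], 0) = 2"
      then show thesis
        using tangent by (intro that[of P]) simp_all
    qed (use simple in simp)
    have mem: "pO \<in> points_over f h 0 0" "P \<in> points_over f h r s"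
      using pO P by simp_all
    have "distinct [pI, pO, P]"
      using points_over_regular(2)[OF mem(1) K_field] points_over_regular(2)[OF mem(2) K_field]
        points_over_disjoint[OF mem(1) _ K_field, of r s] pI(1) mem(2) r by auto
    then have "defines_tame_K2_element K hyp_constants pI pO P"
      using divisor_of_y[OF f0 pI(1,4) pO(1,3)] divisor_of_x_minus_const[OF pI(1,3) P(1,3) tangent on]
      by (intro K.defines_tame_K2_elementI[OF pI(2) pO(2) P(2), of "2 * g + 1" 2]) simp_all
    then show "\<exists>P. points_over f h r s = {P} \<and> defines_tame_K2_element K hyp_constants pI pO P"
      using P(1) by blast
  qed
qed

end

section \<open>Vandermonde interpolation and the discriminant\<close>

lemma vandermonde_mult_index:
  assumes "v \<in> carrier_vec (g + 1)" "k < g + 1"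
  shows "(vandermonde_mat g a *\<^sub>v v) $ k = (\<Sum>j<g+1. v $ j * ((a (Suc k))^2) ^ j)"
proof -
  have V: "dim_row (vandermonde_mat g a) = g + 1"
    by (simp add: vandermonde_mat_def)
  have "row (vandermonde_mat g a) k $ j = ((a (Suc k))^2) ^ j" if "j < g + 1" for j
    using that assms by (simp add: vandermonde_mat_def power_mult)
  then show ?thesis
    using assms V
    by (simp add: scalar_prod_def atLeast0LessThan mult.commute del: sum.lessThan_Suc)
qed

text \<open>
  A vector in the kernel would be the coefficients of a nonzero polynomial of degree at most \<open>g\<close> with
  the \<open>g + 1\<close> roots \<open>a\<^sub>i\<^sup>2\<close>.
\<close>
lemma vandermonde_det_nonzero:
  assumes inj: "inj_on (\<lambda>i. (a i)^2) {1..g+1}"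
  shows "det (vandermonde_mat g a) \<noteq> 0"
proof
  let ?V = "vandermonde_mat g a"
  have V: "?V \<in> carrier_mat (g + 1) (g + 1)"
    by (simp add: vandermonde_mat_def)
  assume "det ?V = 0"
  then obtain v where v: "v \<in> carrier_vec (g + 1)" "v \<noteq> 0\<^sub>v (g + 1)" "?V *\<^sub>v v = 0\<^sub>v (g + 1)"
    using det_0_iff_vec_prod_zero_field[OF V] by auto
  define p where "p = (\<Sum>j<g+1. monom (v $ j) j)"
  have coeff: "coeff p j = (if j < g + 1 then v $ j else 0)" for j
    by (simp add: p_def coeff_sum)
  have root: "poly p ((a i)^2) = 0" if i: "i \<in> {1..g+1}" for i
  proof -
    obtain k where k: "i = Suc k" "k < g + 1"
      using i by (cases i) auto
    show ?thesis
      using vandermonde_mult_index[OF v(1) k(2), of a] v(3) k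
      by (simp add: p_def poly_sum poly_monom del: sum.lessThan_Suc)
  qed
  have "p \<noteq> 0"
  proof
    assume "p = 0"
    then have "v $ j = 0" if "j < g + 1" for j
      using coeff[of j] that by simp
    then have "v = 0\<^sub>v (g + 1)"
      using v(1) by (intro eq_vecI) auto
    then show False using v(2) by contradiction
  qed
  have "(\<lambda>i. (a i)^2) ` {1..g+1} \<subseteq> {x. poly p x = 0}"
    using root by auto
  then have "card ((\<lambda>i. (a i)^2) ` {1..g+1}) \<le> card {x. poly p x = 0}"
    using poly_roots_finite[OF \<open>p \<noteq> 0\<close>] by (intro card_mono) auto
  also have "\<dots> \<le> degree p"
    by (rule card_poly_roots_bound[OF \<open>p \<noteq> 0\<close>])
  also have "\<dots> \<le> g"
    by (rule degree_le) (simp add: coeff)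
  finally show False
    using card_image[OF inj] by simp
qed

lemma degree_f1_poly: "degree (f1_poly g a) \<le> g"
  unfolding f1_poly_def
  by (rule degree_sum_le) (auto intro: order.trans[OF degree_monom_le])

lemma poly_f1_poly:
  assumes inj: "inj_on (\<lambda>i. (a i)^2) {1..g+1}" and i: "i \<in> {1..g+1}"
  shows "poly (f1_poly g a) ((a i)^2) = - 2 * (a i)^(2*g+1)"
proof -
  let ?V = "vandermonde_mat g a" and ?n = "g + 1"
  have V: "?V \<in> carrier_mat ?n ?n"
    by (simp add: vandermonde_mat_def)
  have "?V \<in> Units (ring_mat TYPE(rat) ?n ())"
    by (rule det_non_zero_imp_unit[OF V vandermonde_det_nonzero[OF inj]])
  then obtain B where B: "mat_inverse ?V = Some B"
    using mat_inverse(1)[OF V, where b = "()"] by (cases "mat_inverse ?V") auto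
  then have VB: "?V * B = 1\<^sub>m ?n" "B \<in> carrier_mat ?n ?n"
    using mat_inverse(2)[OF V] by auto
  have w: "w_vec g a \<in> carrier_vec ?n"
    by (simp add: w_vec_def)
  have b: "b_vec g a = B *\<^sub>v w_vec g a" "b_vec g a \<in> carrier_vec ?n"
    using B VB w by (simp_all add: b_vec_def)
  have "?V *\<^sub>v b_vec g a = w_vec g a"
    using VB w V by (simp add: b(1) flip: assoc_mult_mat_vec)
  moreover obtain k where k: "i = Suc k" "k < g + 1"
    using i by (cases i) auto
  moreover have "w_vec g a $ k = - 2 * a i ^ (2 * g + 1)"
    using k by (simp add: w_vec_def)
  moreover have "{0..g} = {..<g+1}" by auto
  ultimately show ?thesis
    using vandermonde_mult_index[OF b(2) k(2), of a]
    by (simp add: f1_poly_def poly_sum poly_monom del: sum.lessThan_Suc)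
qed

lemma poly_disc_no_double_root:
  fixes D :: "rat poly"
  assumes D: "poly_disc D \<noteq> 0" and r: "poly D r = 0"
  shows "poly (pderiv D) r \<noteq> 0"
proof
  assume "poly (pderiv D) r = 0"
  then have dvd: "[:- r, 1:] dvd gcd D (pderiv D)"
    using r by (simp add: poly_eq_0_iff_dvd)
  have "D \<noteq> 0"
    using D by (auto simp: poly_disc_def)
  then have "degree (gcd D (pderiv D)) \<noteq> 0"
    using dvd_imp_degree_le[OF dvd] by simp
  then have "resultant D (pderiv D) = 0"
    by (simp add: resultant_0_gcd)
  then show False
    using D by (simp add: poly_disc_def)
qed

text \<open>
  At \<open>r = a\<^sub>i\<^sup>2\<close>, \<open>s = a\<^sub>i\<^bsup>2g+1\<^esup>\<close> one has \<open>f(r) = - 2 s\<close>, whence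
  \<open>D'(r) = 2 f(r) f'(r) - 4 h'(r) = - 4 (s f'(r) + h'(r))\<close>. So the smoothness condition at \<open>P\<^sub>i\<close> is that \<open>r\<close>
  is a simple root of \<open>D\<close>.
\<close>
theorem proposition4p6:
  fixes g :: nat and a :: "nat \<Rightarrow> rat"
  assumes "g \<ge> 1"
    and "\<forall>i \<in> {1..g+1}. a i \<noteq> 0"
    and "inj_on (\<lambda>i. (a i)^2) {1..g+1}"
    and "poly_disc (- 4 * monom 1 (2*g+1) + (f1_poly g a)^2) \<noteq> 0"
  shows "\<exists>pinf pO.
    points_at_infinity (f1_poly g a) (monom 1 (2*g+1)) = {pinf} \<and>
    points_over (f1_poly g a) (monom 1 (2*g+1)) 0 0 = {pO} \<and>
    (\<forall>i \<in> {1..g+1}. \<exists>p.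
       points_over (f1_poly g a) (monom 1 (2*g+1)) ((a i)^2) ((a i)^(2*g+1)) = {p} \<and>
       defines_tame_K2_element
         (hyp_function_field (f1_poly g a) (monom 1 (2*g+1))) hyp_constants pinf pO p)"
proof -
  define f where "f = f1_poly g a"
  interpret odd_hyperelliptic g f
    by unfold_locales (simp add: f_def degree_f1_poly)
  let ?D = "- 4 * h + f ^ 2"
  have D: "poly_disc ?D \<noteq> 0"
    unfolding f_def by (rule assms(4))
  have Deq: "?D = f * f - smult 4 h"
    by (simp add: power2_eq_square numeral_poly)
  have pD: "poly ?D r = poly f r ^ 2 - 4 * poly h r"
    and dD: "poly (pderiv ?D) r = 2 * poly f r * poly (pderiv f) r - 4 * poly (pderiv h) r" for r
    unfolding Deq by (simp_all add: pderiv_diff pderiv_mult pderiv_smult power2_eq_square)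
  have f0: "poly f 0 \<noteq> 0"
  proof
    assume f0: "poly f 0 = 0"
    (* Here g >= 1 is used: x^(2g+1) and its derivative both vanish at 0. *)
    have "poly h 0 = 0" "poly (pderiv h) 0 = 0"
      using assms(1) by (simp_all add: poly_monom pderiv_monom)
    then have "poly ?D 0 = 0" "poly (pderiv ?D) 0 = 0"
      unfolding pD dD f0 by simp_all
    then show False
      using poly_disc_no_double_root[OF D] by blast
  qed
  have P: "(a i)^2 \<noteq> 0" "((a i)^(2*g+1)) ^ 2 = poly h ((a i)^2)"
      "poly f ((a i)^2) = - 2 * (a i)^(2*g+1)"
      "poly (pderiv h) ((a i)^2) + (a i)^(2*g+1) * poly (pderiv f) ((a i)^2) \<noteq> 0"
    if i: "i \<in> {1..g+1}" for i
  proof -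
    let ?r = "(a i)^2" and ?s = "(a i)^(2*g+1)"
    show "?r \<noteq> 0" using assms(2) i by simp
    show on: "?s ^ 2 = poly h ?r"
      unfolding poly_monom power_mult[symmetric] by (simp add: mult.commute)
    show tangent: "poly f ?r = - 2 * ?s"
      unfolding f_def by (rule poly_f1_poly[OF assms(3) i])
    have "poly ?D ?r = 0"
      unfolding pD tangent on[symmetric] by (simp add: power2_eq_square)
    then have "poly (pderiv ?D) ?r \<noteq> 0"
      by (rule poly_disc_no_double_root[OF D])
    then show "poly (pderiv h) ?r + ?s * poly (pderiv f) ?r \<noteq> 0"
      unfolding dD tangent by auto
  qed
  show ?thesis
  proof (rule tangent_points_define_tame_K2_elements[OF f0])
    fix pI pO
    assume IO: "points_at_infinity f h = {pI}" "points_over f h 0 0 = {pO}"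
      and ex: "\<And>r s. r \<noteq> 0 \<Longrightarrow> s ^ 2 = poly h r \<Longrightarrow> poly f r = - 2 * s \<Longrightarrow>
        poly (pderiv h) r + s * poly (pderiv f) r \<noteq> 0 \<Longrightarrow>
        \<exists>P. points_over f h r s = {P} \<and> defines_tame_K2_element K hyp_constants pI pO P"
    show ?thesis
      unfolding f_def[symmetric]
      by (rule exI[of _ pI], rule exI[of _ pO], intro conjI ballI IO) (rule ex[OF P])
  qed
qed

end
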